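(* Let $X\subseteq\mathbb R^n$ be a nonempty compact convex set. The following are equivalent: (I) the Riesz space $\mathcal R(X)$ is strongly semisimple; (II) $X=\operatorname{conv}(x_1,\ldots,x_m)$ for some finitely many points $x_1,\ldots,x_m\in\mathbb R^n$, i.e. $X$ is a polyhedron; (III) $X$ has no outgoing tangent.
   Context: For $y\in\mathbb R^n$ and a linear subspace $L$, $\mathsf{proj}_L(y)$ is the orthogonal projection. Frenet frame of a sequence $\{x_i\}$ converging to $x$: $u_1$ is its Frenet $1$-frame if $x_i\ne x$ for all $i$ and $u_1=\lim_i (x_i-x)/\|x_i-x\|$; a $k$-tuple $(u_1,\ldots,u_k)$ of pairwise orthogonal unit vectors is its Frenet $k$-frame if $(u_1,\ldots,u_{k-1})$ is its Frenet $(k-1)$-frame and $u_k=\lim_i\frac{x_i-x-\mathsf{proj}_{\mathbb Ru_1+\cdots+\mathbb Ru_{k-1}}(x_i-x)}{\|x_i-x-\mathsf{proj}_{\mathbb Ru_1+\cdots+\mathbb Ru_{k-1}}(x_i-x)\|}$ (nonzero denominators). Tangent: $u=(u_1,\ldots,u_k)$ is a tangent of $X$ at $x$ if $X$ contains a sequence converging to $x$ whose Frenet $k$-frame is $u$; it is outgoing if there are $\lambda_1,\ldots,\lambda_k>0$ with $C\cap X=C'\cap X$, where $C=\operatorname{conv}(x,x+\lambda_1u_1,\ldots,x+\lambda_1u_1+\cdots+\lambda_ku_k)$ and $C'=\operatorname{conv}(x,x+\lambda_1u_1,\ldots,x+\lambda_1u_1+\cdots+\lambda_{k-1}u_{k-1})$.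 $\mathcal R(X)$: restrictions to $X$ of functions on a closed $n$-cube $K\supseteq X$ that are continuous and affine linear on each simplex of some triangulation of $K$; a Riesz space under pointwise operations. Principal ideal generated by $g$: $\{f:|f|\le m|g|\text{ for some }m\in\mathbb N\}$. Strongly semisimple: every principal ideal is an intersection of maximal ideals. *)

theory Defs
  imports "HOL-Analysis.Analysis"
begin

definition frenet_residual :: "'a::euclidean_space list \<Rightarrow> nat \<Rightarrow> 'a \<Rightarrow> 'a \<Rightarrow> 'a" where
  "frenet_residual us k x y = (y - x) - (\<Sum>j<k. ((y - x) \<bullet> (us ! j)) *\<^sub>R (us ! j))"

definition frenet_frame :: "(nat \<Rightarrow> 'a::euclidean_space) \<Rightarrow> 'a \<Rightarrow> 'a list \<Rightarrow> bool" where
  "frenet_frame xs x us \<longleftrightarrow>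
     us \<noteq> [] \<and> xs \<longlonglongrightarrow> x \<and> (\<forall>i. xs i \<noteq> x) \<and>
     (\<forall>j<length us. norm (us ! j) = 1) \<and>
     (\<forall>j<length us. \<forall>l<length us. j \<noteq> l \<longrightarrow> (us ! j) \<bullet> (us ! l) = 0) \<and>
     (\<forall>k<length us. (\<forall>i. frenet_residual us k x (xs i) \<noteq> 0) \<and>
        (\<lambda>i. (1 / norm (frenet_residual us k x (xs i))) *\<^sub>R frenet_residual us k x (xs i))
          \<longlonglongrightarrow> us ! k)"

definition tangent :: "'a::euclidean_space set \<Rightarrow> 'a \<Rightarrow> 'a list \<Rightarrow> bool" where
  "tangent X x us \<longleftrightarrow> (\<exists>xs. (\<forall>i. xs i \<in> X) \<and> frenet_frame xs x us)"

definition outgoing_tangent :: "'a::euclidean_space set \<Rightarrow> 'a \<Rightarrow> 'a list \<Rightarrow> bool" where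
  "outgoing_tangent X x us \<longleftrightarrow> tangent X x us \<and>
     (\<exists>lam :: nat \<Rightarrow> real. (\<forall>j<length us. lam j > 0) \<and>
        (let p = (\<lambda>i. x + (\<Sum>j<i. lam j *\<^sub>R (us ! j))) in
          convex hull (p ` {..length us}) \<inter> X = convex hull (p ` {..<length us}) \<inter> X))"

definition triangulation_of :: "'a::euclidean_space set set \<Rightarrow> 'a set \<Rightarrow> bool" where
  "triangulation_of T K \<longleftrightarrow> finite T \<and> (\<forall>S\<in>T. \<exists>d. d simplex S) \<and> \<Union>T = K \<and>
     (\<forall>S\<in>T. \<forall>S'\<in>T. (S \<inter> S') face_of S \<and> (S \<inter> S') face_of S')"

definition ncube :: "'a::euclidean_space set \<Rightarrow> bool" where
  "ncube K \<longleftrightarrow> (\<exists>a r. r > 0 \<and> K = cbox a (a + r *\<^sub>R One))"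

text \<open>R(X): functions on X (represented as 0 outside X) that are restrictions of continuous
  piecewise affine-linear functions on a closed cube containing X.\<close>
definition RX :: "'a::euclidean_space set \<Rightarrow> ('a \<Rightarrow> real) set" where
  "RX X = {g. (\<forall>y. y \<notin> X \<longrightarrow> g y = 0) \<and>
     (\<exists>K T f. ncube K \<and> X \<subseteq> K \<and> triangulation_of T K \<and> continuous_on K f \<and>
        (\<forall>S\<in>T. \<exists>w c. \<forall>y\<in>S. f y = w \<bullet> y + c) \<and> (\<forall>y\<in>X. g y = f y))}"

definition riesz_ideal :: "'a::euclidean_space set \<Rightarrow> ('a \<Rightarrow> real) set \<Rightarrow> bool" where
  "riesz_ideal X I \<longleftrightarrow> I \<subseteq> RX X \<and> (\<lambda>y. 0) \<in> I \<and>
     (\<forall>f\<in>I. \<forall>g\<in>I. (\<lambda>y. f y + g y) \<in> I) \<and>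
     (\<forall>c f. f \<in> I \<longrightarrow> (\<lambda>y. c * f y) \<in> I) \<and>
     (\<forall>f\<in>RX X. \<forall>g\<in>I. (\<forall>y. \<bar>f y\<bar> \<le> \<bar>g y\<bar>) \<longrightarrow> f \<in> I)"

definition maximal_riesz_ideal :: "'a::euclidean_space set \<Rightarrow> ('a \<Rightarrow> real) set \<Rightarrow> bool" where
  "maximal_riesz_ideal X M \<longleftrightarrow> riesz_ideal X M \<and> M \<noteq> RX X \<and>
     (\<forall>J. riesz_ideal X J \<and> M \<subseteq> J \<longrightarrow> J = M \<or> J = RX X)"

definition principal_ideal :: "'a::euclidean_space set \<Rightarrow> ('a \<Rightarrow> real) \<Rightarrow> ('a \<Rightarrow> real) set" where
  "principal_ideal X g = {f \<in> RX X. \<exists>m::nat. \<forall>y. \<bar>f y\<bar> \<le> real m * \<bar>g y\<bar>}"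

text \<open>Every principal ideal is an intersection of maximal ideals (the empty intersection
  being the whole space R(X)).\<close>
definition strongly_semisimple :: "'a::euclidean_space set \<Rightarrow> bool" where
  "strongly_semisimple X \<longleftrightarrow> (\<forall>g\<in>RX X. \<exists>\<M>. (\<forall>M\<in>\<M>. maximal_riesz_ideal X M) \<and>
       principal_ideal X g = RX X \<inter> \<Inter>\<M>)"

end

theory Submission
  imports Defs
begin

text \<open>For compact \<open>X\<close> the maximal ideals of \<open>RX X\<close> are the sets of functions vanishing at a point
  of \<open>X\<close>, so strong semisimplicity says that \<open>f\<close> is bounded by a multiple of \<open>g\<close> whenever \<open>f\<close>
  vanishes on the zeros of \<open>g\<close>. On a polytope this follows by subdividing into cells on which
  \<open>\<bar>f\<bar>\<close> and \<open>\<bar>g\<bar>\<close> are affine and comparing them at the vertices. For an outgoing tangent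
  \<open>(u\<^sub>1, \<dots>, u\<^sub>k)\<close> with simplex \<open>C\<close> it fails for \<open>f = \<bar>u\<^sub>k \<bullet> (y - x)\<bar>\<close> and \<open>g\<close> a
  piecewise affine substitute for the distance to \<open>C\<close>, since \<open>g\<close> is of smaller order than
  \<open>f\<close> along the sequence defining the tangent. Finally, a compact convex set that is not a
  polytope has a convergent sequence of distinct extreme points, which one may assume to have a
  Frenet frame spanning its eventual positions relative to the limit; if no initial segment of
  this frame is outgoing, then \<open>X\<close> contains a simplex along the frame, and late terms of the
  sequence lie in its relative interior, contradicting extremality.\<close>

section \<open>Piecewise affine functions\<close>

text \<open>Encoded as a continuous global selection from finitely many affine functions, with no
  triangulation: sums and absolute values then only need finite sets of combined pieces instead of
  common refinements.\<close>

definition piecewise_affine :: "('a::euclidean_space \<Rightarrow> real) \<Rightarrow> bool" where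
  "piecewise_affine F \<longleftrightarrow> continuous_on UNIV F \<and>
     (\<exists>A. finite A \<and> (\<forall>y. \<exists>(w, c)\<in>A. F y = w \<bullet> y + c))"

lemma piecewise_affine_affine: "piecewise_affine (\<lambda>y. w \<bullet> y + c)"
  unfolding piecewise_affine_def
  by (intro conjI exI[of _ "{(w, c)}"]) (auto intro!: continuous_intros)

lemma piecewise_affine_add:
  assumes "piecewise_affine F" "piecewise_affine G"
  shows "piecewise_affine (\<lambda>y. F y + G y)"
proof -
  from assms obtain A B where A: "finite A" "\<And>y. \<exists>(w, c)\<in>A. F y = w \<bullet> y + c"
    and B: "finite B" "\<And>y. \<exists>(w, c)\<in>B. G y = w \<bullet> y + c"
    unfolding piecewise_affine_def by blast
  let ?D = "(\<lambda>(p, q). (fst p + fst q, snd p + snd q)) ` (A \<times> B)"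
  have "\<exists>(w, c)\<in>?D. F y + G y = w \<bullet> y + c" for y
  proof -
    obtain w c where 1: "(w, c) \<in> A" "F y = w \<bullet> y + c" using A(2)[of y] by auto
    obtain v d where 2: "(v, d) \<in> B" "G y = v \<bullet> y + d" using B(2)[of y] by auto
    have "(w + v, c + d) \<in> ?D" using 1 2 by (force simp: image_iff)
    then show ?thesis using 1 2 by (intro bexI[of _ "(w + v, c + d)"]) (auto simp: inner_add_left)
  qed
  moreover have "finite ?D" using A(1) B(1) by blast
  moreover have "continuous_on UNIV (\<lambda>y. F y + G y)"
    using assms unfolding piecewise_affine_def by (auto intro!: continuous_intros)
  ultimately show ?thesis unfolding piecewise_affine_def by blast
qed

lemma piecewise_affine_cmult:
  assumes "piecewise_affine F"
  shows "piecewise_affine (\<lambda>y. k * F y)"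
proof -
  from assms obtain A where A: "finite A" "\<And>y. \<exists>(w, c)\<in>A. F y = w \<bullet> y + c"
    unfolding piecewise_affine_def by blast
  let ?D = "(\<lambda>(w, c). (k *\<^sub>R w, k * c)) ` A"
  have "\<exists>(w, c)\<in>?D. k * F y = w \<bullet> y + c" for y
    using A(2)[of y] by (force simp: algebra_simps)
  moreover have "finite ?D" using A(1) by blast
  moreover have "continuous_on UNIV (\<lambda>y. k * F y)"
    using assms unfolding piecewise_affine_def by (auto intro!: continuous_intros)
  ultimately show ?thesis unfolding piecewise_affine_def by blast
qed

lemma piecewise_affine_abs:
  assumes "piecewise_affine F"
  shows "piecewise_affine (\<lambda>y. \<bar>F y\<bar>)"
proof -
  from assms obtain A where A: "finite A" "\<And>y. \<exists>(w, c)\<in>A. F y = w \<bullet> y + c"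
    unfolding piecewise_affine_def by blast
  let ?D = "A \<union> (\<lambda>(w, c). (- w, - c)) ` A"
  have "\<exists>(w, c)\<in>?D. \<bar>F y\<bar> = w \<bullet> y + c" for y
  proof -
    obtain w c where wc: "(w, c) \<in> A" "F y = w \<bullet> y + c" using A(2)[of y] by auto
    show ?thesis
    proof (cases "F y \<ge> 0")
      case True
      then show ?thesis using wc by (intro bexI[of _ "(w, c)"]) auto
    next
      case False
      moreover have "(- w, - c) \<in> ?D" using wc by force
      ultimately show ?thesis using wc by (intro bexI[of _ "(- w, - c)"]) auto
    qed
  qed
  moreover have "finite ?D" using A(1) by blast
  moreover have "continuous_on UNIV (\<lambda>y. \<bar>F y\<bar>)"
    using assms unfolding piecewise_affine_def by (auto intro!: continuous_intros)
  ultimately show ?thesis unfolding piecewise_affine_def by blast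
qed

lemma piecewise_affine_sum:
  assumes "finite I" "\<And>i. i \<in> I \<Longrightarrow> piecewise_affine (F i)"
  shows "piecewise_affine (\<lambda>y. \<Sum>i\<in>I. F i y)"
  using assms
proof (induction rule: finite_induct)
  case empty
  show ?case using piecewise_affine_affine[of 0 0] by simp
qed (simp add: piecewise_affine_add)

lemma piecewise_affine_pos_part:
  assumes "piecewise_affine F"
  shows "piecewise_affine (\<lambda>y. max 0 (F y))"
proof -
  have eq: "(\<lambda>y. max 0 (F y)) = (\<lambda>y. (1/2) * (F y + \<bar>F y\<bar>))" by (auto simp: max_def)
  show ?thesis
    unfolding eq
    by (rule piecewise_affine_cmult[OF piecewise_affine_add[OF assms piecewise_affine_abs[OF assms]]])
qed

text \<open>In the relative interior of \<open>S\<close> two distinct pieces never agree, so connectedness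
  lets a continuous selection use only one of them.\<close>
lemma piecewise_affine_on_coherent:
  fixes F :: "'a::euclidean_space \<Rightarrow> real"
  assumes cont: "continuous_on UNIV F" and fin: "finite A"
    and sel: "\<And>y. \<exists>(w, c)\<in>A. F y = w \<bullet> y + c"
    and "convex S"
    and coh: "\<And>w c v d y z. \<lbrakk>(w, c) \<in> A; (v, d) \<in> A; y \<in> S; z \<in> S\<rbrakk> \<Longrightarrow>
        (w - v) \<bullet> y \<le> d - c \<and> (w - v) \<bullet> z \<le> d - c \<or> (w - v) \<bullet> y \<ge> d - c \<and> (w - v) \<bullet> z \<ge> d - c"
  shows "\<exists>w c. \<forall>y\<in>S. F y = w \<bullet> y + c"
proof (cases "S = {}")
  case False
  let ?R = "rel_interior S"
  obtain z where z: "z \<in> ?R" using False \<open>convex S\<close> by (metis ex_in_conv rel_interior_eq_empty)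
  obtain w c where wc: "(w, c) \<in> A" "F z = w \<bullet> z + c" using sel[of z] by auto
  \<comment> \<open>Pieces agreeing with \<open>(w, c)\<close> on all of \<open>S\<close> are left
    out; the remaining ones are to be kept apart from it on \<open>?R\<close>.\<close>
  define A' where "A' = {(v, d)\<in>A. \<exists>s\<in>S. v \<bullet> s + d \<noteq> w \<bullet> s + c}"
  have apart: "v \<bullet> y + d \<noteq> w \<bullet> y + c" if vd: "(v, d) \<in> A'" and y: "y \<in> ?R" for v d y
  proof
    assume eq: "v \<bullet> y + d = w \<bullet> y + c"
    from vd obtain s where s: "s \<in> S" "v \<bullet> s + d \<noteq> w \<bullet> s + c" and vdA: "(v, d) \<in> A"
      by (auto simp: A'_def)
    \<comment> \<open>The segment from \<open>s\<close> to \<open>y\<close> is prolonged slightly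
      beyond \<open>y\<close>. An affine function vanishing at \<open>y\<close> but not at
      \<open>s\<close> has opposite signs at the two ends, which \<open>coh\<close>
      excludes.\<close>
    obtain e where e: "e > 1" "(1 - e) *\<^sub>R s + e *\<^sub>R y \<in> S"
      using y s(1) convex_rel_interior_iff[OF \<open>convex S\<close> False] by blast
    define D where "D = (w - v) \<bullet> s - (d - c)"
    have "D \<noteq> 0" using s(2) by (simp add: D_def algebra_simps)
    have "(w - v) \<bullet> y = d - c" using eq by (simp add: algebra_simps)
    then have "(w - v) \<bullet> ((1 - e) *\<^sub>R s + e *\<^sub>R y) - (d - c) = (1 - e) * D"
      by (simp add: D_def inner_add_right) (simp add: algebra_simps)
    moreover have "D \<le> 0 \<and> (1 - e) * D \<le> 0 \<or> D \<ge> 0 \<and> (1 - e) * D \<ge> 0"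
      using coh[OF wc(1) vdA s(1) e(2)] calculation by (auto simp: D_def)
    ultimately show False
      using \<open>D \<noteq> 0\<close> e(1) by (auto simp: mult_le_0_iff zero_le_mult_iff)
  qed
  define P where "P = {y. F y = w \<bullet> y + c}"
  define Q where "Q = (\<Union>(v, d)\<in>A'. {y. F y = v \<bullet> y + d})"
  have closed_piece: "closed {y. F y = v \<bullet> y + d}" for v d
    by (intro closed_Collect_eq cont continuous_intros)
  have "closed P" unfolding P_def by (rule closed_piece)
  moreover have "finite A'" using fin unfolding A'_def by (rule rev_finite_subset) auto
  then have "closed Q" unfolding Q_def using closed_piece by (auto intro!: closed_UN)
  moreover have "?R \<subseteq> P \<union> Q"
  proof
    fix y assume y: "y \<in> ?R"
    obtain v d where vd: "(v, d) \<in> A" "F y = v \<bullet> y + d" using sel[of y] by auto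
    show "y \<in> P \<union> Q"
    proof (cases "(v, d) \<in> A'")
      case True
      then show ?thesis using vd by (auto simp: Q_def)
    next
      case False
      then have "v \<bullet> y + d = w \<bullet> y + c"
        using vd y rel_interior_subset by (auto simp: A'_def)
      then show ?thesis using vd by (simp add: P_def)
    qed
  qed
  moreover have "P \<inter> Q \<inter> ?R = {}" using apart by (auto simp: P_def Q_def)
  moreover have "P \<inter> ?R \<noteq> {}" using z wc by (auto simp: P_def)
  moreover have "connected ?R"
    using \<open>convex S\<close> by (simp add: convex_connected convex_rel_interior)
  ultimately have "Q \<inter> ?R = {}"
    using connected_closedD[of ?R P Q] by blast
  then have "?R \<subseteq> P" using \<open>?R \<subseteq> P \<union> Q\<close> by blast
  then have "closure ?R \<subseteq> P" using \<open>closed P\<close> by (simp add: closure_minimal)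
  then have "S \<subseteq> P"
    using convex_closure_rel_interior[OF \<open>convex S\<close>] closure_subset[of S] by auto
  then show ?thesis by (auto simp: P_def)
qed auto

section \<open>Subdividing polytopes into cells of affinity\<close>

text \<open>Cutting \<open>K\<close> along the hyperplanes where two pieces of the same
  \<open>F i\<close> agree leaves cells on which no such difference of pieces changes sign, so each
  \<open>F i\<close> uses a single affine formula there.\<close>

lemma piecewise_affine_subdivision:
  fixes F :: "'i \<Rightarrow> 'a::euclidean_space \<Rightarrow> real"
  assumes "polytope K" "finite I" and F: "\<And>i. i \<in> I \<Longrightarrow> piecewise_affine (F i)"
  obtains \<G> where "finite \<G>" "\<Union>\<G> = K" "\<And>C. C \<in> \<G> \<Longrightarrow> polytope C"
    "\<And>C D. C \<in> \<G> \<Longrightarrow> D \<in> \<G> \<Longrightarrow> C \<inter> D face_of C"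
    "\<And>C i. C \<in> \<G> \<Longrightarrow> i \<in> I \<Longrightarrow> \<exists>w c. \<forall>y\<in>C. F i y = w \<bullet> y + c"
proof -
  have "\<forall>i\<in>I. \<exists>A. finite A \<and> (\<forall>y. \<exists>(w, c)\<in>A. F i y = w \<bullet> y + c)"
    using F unfolding piecewise_affine_def by blast
  then obtain A where A: "\<And>i. i \<in> I \<Longrightarrow> finite (A i)"
    "\<And>i y. i \<in> I \<Longrightarrow> \<exists>(w, c)\<in>A i. F i y = w \<bullet> y + c"
    by metis
  \<comment> \<open>The pair \<open>(w - v, d - c)\<close> encodes the hyperplane on which
    \<open>w \<bullet> y + c\<close> equals \<open>v \<bullet> y + d\<close>.\<close>
  define H where "H = (\<Union>i\<in>I. (\<lambda>(p, q). (fst p - fst q, snd q - snd p)) ` (A i \<times> A i))"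
  have "finite H" using A(1) \<open>finite I\<close> by (auto simp: H_def)
  have "\<exists>\<G>. \<Union>\<G> = \<Union>{K} \<and> finite \<G> \<and> (\<forall>C\<in>\<G>. \<exists>D. D \<in> {K} \<and> C \<subseteq> D) \<and>
      (\<forall>C\<in>{K}. \<forall>x\<in>C. \<exists>D. D \<in> \<G> \<and> x \<in> D \<and> D \<subseteq> C) \<and> (\<forall>C\<in>\<G>. polytope C) \<and>
      (\<forall>C\<in>\<G>. aff_dim C \<le> int DIM('a)) \<and> (\<forall>C\<in>\<G>. \<forall>D\<in>\<G>. C \<inter> D face_of C) \<and>
      (\<forall>C\<in>\<G>. \<forall>y\<in>C. \<forall>z\<in>C. \<forall>a b. (a, b) \<in> H \<longrightarrow>
         a \<bullet> y \<le> b \<and> a \<bullet> z \<le> b \<or> a \<bullet> y \<ge> b \<and> a \<bullet> z \<ge> b)"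
    using \<open>finite H\<close> \<open>polytope K\<close>
    by (intro cell_subdivision_lemma) (auto simp: aff_dim_le_DIM face_of_refl polytope_imp_convex)
  then obtain \<G> where \<G>: "\<Union>\<G> = K" "finite \<G>" "\<forall>C\<in>\<G>. polytope C"
      "\<forall>C\<in>\<G>. \<forall>D\<in>\<G>. C \<inter> D face_of C"
    and sign: "\<forall>C\<in>\<G>. \<forall>y\<in>C. \<forall>z\<in>C. \<forall>a b. (a, b) \<in> H \<longrightarrow>
        a \<bullet> y \<le> b \<and> a \<bullet> z \<le> b \<or> a \<bullet> y \<ge> b \<and> a \<bullet> z \<ge> b"
    by (elim exE conjE) simp
  show ?thesis
  proof
    show "\<exists>w c. \<forall>y\<in>C. F i y = w \<bullet> y + c" if "C \<in> \<G>" "i \<in> I" for C i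
    proof (rule piecewise_affine_on_coherent[of _ "A i"])
      show "continuous_on UNIV (F i)" using F \<open>i \<in> I\<close> by (simp add: piecewise_affine_def)
      show "convex C" using \<G>(3) that by (simp add: polytope_imp_convex)
      fix w c v d y z
      assume "(w, c) \<in> A i" "(v, d) \<in> A i" "y \<in> C" "z \<in> C"
      moreover from this have "(w - v, d - c) \<in> H"
        using \<open>i \<in> I\<close> by (force simp: H_def)
      ultimately show "(w - v) \<bullet> y \<le> d - c \<and> (w - v) \<bullet> z \<le> d - c \<or>
          (w - v) \<bullet> y \<ge> d - c \<and> (w - v) \<bullet> z \<ge> d - c"
        using sign \<open>C \<in> \<G>\<close> by blast
    qed (use A \<open>i \<in> I\<close> in auto)
  qed (use \<G> in auto)
qed

text \<open>The cells of affinity form a cell complex, which has a simplicial subdivision; each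
  simplex inherits the affine formula of a cell containing it.\<close>

lemma piecewise_affine_triangulation:
  fixes F :: "'a::euclidean_space \<Rightarrow> real"
  assumes "polytope K" "piecewise_affine F"
  obtains T where "triangulation_of T K" "\<And>S. S \<in> T \<Longrightarrow> \<exists>w c. \<forall>y\<in>S. F y = w \<bullet> y + c"
proof -
  obtain \<G> where \<G>: "finite \<G>" "\<Union>\<G> = K" "\<And>C. C \<in> \<G> \<Longrightarrow> polytope C"
    "\<And>C D. C \<in> \<G> \<Longrightarrow> D \<in> \<G> \<Longrightarrow> C \<inter> D face_of C"
    "\<And>C. C \<in> \<G> \<Longrightarrow> \<exists>w c. \<forall>y\<in>C. F y = w \<bullet> y + c"
    using piecewise_affine_subdivision[of K "{()}" "\<lambda>_. F"] assms
    by (metis finite.emptyI finite_insert singletonI)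
  obtain T where T: "simplicial_complex T" "\<Union>T = \<Union>\<G>" "\<And>S. S \<in> T \<Longrightarrow> \<exists>C. C \<in> \<G> \<and> S \<subseteq> C"
    using simplicial_subdivision_of_cell_complex[OF \<G>(1) \<G>(3) \<G>(4)] by metis
  show ?thesis
  proof
    show "triangulation_of T K"
      using T \<G>(2) unfolding simplicial_complex_def triangulation_of_def
      by (metis inf_commute)
    show "\<exists>w c. \<forall>y\<in>S. F y = w \<bullet> y + c" if "S \<in> T" for S
      using T(3)[OF that] \<G>(5) by blast
  qed
qed

section \<open>R(X) as restrictions of global piecewise affine functions\<close>

lemma bounded_subset_ncube:
  fixes X :: "'a::euclidean_space set"
  assumes "bounded X"
  obtains K where "ncube K" "X \<subseteq> K"
proof -
  obtain B where B: "B > 0" "\<And>x. x \<in> X \<Longrightarrow> norm x \<le> B"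
    using assms by (meson bounded_pos)
  let ?a = "- (B *\<^sub>R One) :: 'a"
  have "X \<subseteq> cbox ?a (?a + (2 * B) *\<^sub>R One)"
  proof
    fix x assume "x \<in> X"
    then have "\<bar>x \<bullet> i\<bar> \<le> B" if "i \<in> Basis" for i
      using B(2) Basis_le_norm[OF that, of x] by force
    then show "x \<in> cbox ?a (?a + (2 * B) *\<^sub>R One)"
      by (auto simp: mem_box inner_add_left inner_minus_left inner_diff_left abs_le_iff minus_le_iff)
  qed
  then show ?thesis
    using B(1) that unfolding ncube_def
    by (metis mult_pos_pos zero_less_numeral)
qed

text \<open>\<open>clamp\<close> is affine on each of the regions determined by comparing every
  coordinate with the bounds, so composing with it extends \<open>f\<close> from the box to the
  whole space with finitely many affine pieces.\<close>

lemma piecewise_affine_clamp: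
  fixes f :: "'a::euclidean_space \<Rightarrow> real"
  assumes ab: "\<And>i. i \<in> Basis \<Longrightarrow> a \<bullet> i \<le> b \<bullet> i" and cont: "continuous_on (cbox a b) f"
    and "finite A" and sel: "\<And>y. y \<in> cbox a b \<Longrightarrow> \<exists>(w, c)\<in>A. f y = w \<bullet> y + c"
  shows "piecewise_affine (\<lambda>y. f (clamp a b y))"
proof -
  \<comment> \<open>A code in \<open>?\<Sigma>\<close> tells for each coordinate whether it lies
    below the box (0), within its bounds (1) or above (2); \<open>v\<close> keeps the coordinates
    left unchanged, \<open>d\<close> collects the constants from the others.\<close>
  let ?\<Sigma> = "Basis \<rightarrow>\<^sub>E {0, 1, 2::nat}"
  define v where "v = (\<lambda>(w::'a) \<sigma>. \<Sum>i\<in>Basis. (if \<sigma> i = (1::nat) then w \<bullet> i else 0) *\<^sub>R i)"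
  define d where "d = (\<lambda>(w::'a) \<sigma>. \<Sum>i\<in>Basis. (if \<sigma> i = (1::nat) then 0
      else if \<sigma> i = 0 then (a \<bullet> i) * (w \<bullet> i) else (b \<bullet> i) * (w \<bullet> i)))"
  let ?D = "(\<lambda>((w, c), \<sigma>). (v w \<sigma>, d w \<sigma> + c)) ` (A \<times> ?\<Sigma>)"
  have "\<exists>(w, c)\<in>?D. f (clamp a b y) = w \<bullet> y + c" for y
  proof -
    obtain w c where wc: "(w, c) \<in> A" "f (clamp a b y) = w \<bullet> clamp a b y + c"
      using sel[of "clamp a b y"] ab by auto
    define \<sigma> where "\<sigma> = restrict (\<lambda>i. if y \<bullet> i < a \<bullet> i then 0
        else if y \<bullet> i \<le> b \<bullet> i then 1 else (2::nat)) Basis"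
    have "\<sigma> \<in> ?\<Sigma>" by (auto simp: \<sigma>_def)
    have "w \<bullet> clamp a b y = v w \<sigma> \<bullet> y + d w \<sigma>"
      using ab unfolding clamp_def v_def d_def inner_sum_right inner_sum_left sum.distrib[symmetric]
      by (auto simp: \<sigma>_def sum.distrib[symmetric] inner_sum_right inner_commute intro!: sum.cong)
    then have "f (clamp a b y) = v w \<sigma> \<bullet> y + (d w \<sigma> + c)" using wc by simp
    moreover have "(v w \<sigma>, d w \<sigma> + c) \<in> ?D"
      using wc \<open>\<sigma> \<in> ?\<Sigma>\<close> by (intro image_eqI[of _ _ "((w, c), \<sigma>)"]) simp_all
    ultimately show ?thesis by (intro bexI[of _ "(v w \<sigma>, d w \<sigma> + c)"]) simp_all
  qed
  moreover have "finite ?D"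
    using \<open>finite A\<close> by (intro finite_imageI finite_cartesian_product finite_PiE) auto
  ultimately show ?thesis
    unfolding piecewise_affine_def using clamp_continuous_on[OF cont] by blast
qed

text \<open>Two elements of \<open>RX X\<close> may come with different cubes and triangulations;
  global functions remove this dependence. Clamping to the cube gives one direction, triangulating
  any cube around \<open>X\<close> the other.\<close>

lemma RX_iff_piecewise_affine:
  fixes X :: "'a::euclidean_space set"
  assumes "bounded X"
  shows "g \<in> RX X \<longleftrightarrow> (\<forall>y. y \<notin> X \<longrightarrow> g y = 0) \<and> (\<exists>F. piecewise_affine F \<and> (\<forall>y\<in>X. g y = F y))"
proof
  assume "g \<in> RX X"
  then obtain K T f where g: "\<forall>y. y \<notin> X \<longrightarrow> g y = 0" "ncube K" "X \<subseteq> K" "triangulation_of T K"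
      "continuous_on K f" "\<forall>S\<in>T. \<exists>w c. \<forall>y\<in>S. f y = w \<bullet> y + c" "\<forall>y\<in>X. g y = f y"
    unfolding RX_def by blast
  obtain a r where K: "r > 0" "K = cbox a (a + r *\<^sub>R One)"
    using g(2) by (auto simp: ncube_def)
  let ?b = "a + r *\<^sub>R One"
  have ab: "a \<bullet> i \<le> ?b \<bullet> i" if "i \<in> Basis" for i using K that by (simp add: inner_add_left)
  obtain w c where wc: "\<And>S y. S \<in> T \<Longrightarrow> y \<in> S \<Longrightarrow> f y = w S \<bullet> y + c S"
    using g(6) by metis
  have "piecewise_affine (\<lambda>y. f (clamp a ?b y))"
  proof (rule piecewise_affine_clamp[OF ab])
    show "continuous_on (cbox a ?b) f" using g K by simp
    show "finite ((\<lambda>S. (w S, c S)) ` T)" using g(4) by (simp add: triangulation_of_def)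
    show "\<exists>(w, c)\<in>(\<lambda>S. (w S, c S)) ` T. f y = w \<bullet> y + c" if "y \<in> cbox a ?b" for y
      using that K g(4) wc by (force simp: triangulation_of_def)
  qed
  moreover have "\<forall>y\<in>X. g y = f (clamp a ?b y)" using g(3,7) K by (metis clamp_cancel_cbox subsetD)
  ultimately show "(\<forall>y. y \<notin> X \<longrightarrow> g y = 0) \<and> (\<exists>F. piecewise_affine F \<and> (\<forall>y\<in>X. g y = F y))"
    using g(1) by (auto intro!: exI[of _ "\<lambda>y. f (clamp a ?b y)"])
next
  assume R: "(\<forall>y. y \<notin> X \<longrightarrow> g y = 0) \<and> (\<exists>F. piecewise_affine F \<and> (\<forall>y\<in>X. g y = F y))"
  then obtain F where F: "piecewise_affine F" "\<forall>y\<in>X. g y = F y" by blast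
  obtain K where K: "ncube K" "X \<subseteq> K" using bounded_subset_ncube[OF assms] by blast
  then have "polytope K" by (auto simp: ncube_def polytope_interval)
  then obtain T where T: "triangulation_of T K" "\<And>S. S \<in> T \<Longrightarrow> \<exists>w c. \<forall>y\<in>S. F y = w \<bullet> y + c"
    using piecewise_affine_triangulation F(1) by blast
  have "continuous_on K F" using F(1) continuous_on_subset by (auto simp: piecewise_affine_def)
  then show "g \<in> RX X" unfolding RX_def using R F K T by blast
qed

section \<open>Ideals of the Riesz space\<close>

lemma RX_restrict:
  assumes "bounded X" "piecewise_affine F"
  shows "(\<lambda>y. if y \<in> X then F y else 0) \<in> RX X"
  using assms by (auto simp: RX_iff_piecewise_affine)

lemma RX_outside: "f \<in> RX X \<Longrightarrow> y \<notin> X \<Longrightarrow> f y = 0"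
  by (simp add: RX_def)

lemma RX_add:
  assumes "bounded X" "f \<in> RX X" "g \<in> RX X"
  shows "(\<lambda>y. f y + g y) \<in> RX X"
proof -
  obtain F G where "piecewise_affine F" "\<forall>y\<in>X. f y = F y" "piecewise_affine G" "\<forall>y\<in>X. g y = G y"
    using assms by (auto simp: RX_iff_piecewise_affine)
  then have "piecewise_affine (\<lambda>y. F y + G y)" "\<forall>y\<in>X. f y + g y = F y + G y"
    by (auto intro: piecewise_affine_add)
  then show ?thesis using assms by (auto simp: RX_iff_piecewise_affine RX_outside)
qed

lemma RX_cmult:
  assumes "bounded X" "f \<in> RX X"
  shows "(\<lambda>y. k * f y) \<in> RX X"
proof -
  obtain F where "piecewise_affine F" "\<forall>y\<in>X. f y = F y"
    using assms by (auto simp: RX_iff_piecewise_affine)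
  then have "piecewise_affine (\<lambda>y. k * F y)" "\<forall>y\<in>X. k * f y = k * F y"
    by (auto intro: piecewise_affine_cmult)
  then show ?thesis using assms by (auto simp: RX_iff_piecewise_affine RX_outside)
qed

lemma RX_abs:
  assumes "bounded X" "f \<in> RX X"
  shows "(\<lambda>y. \<bar>f y\<bar>) \<in> RX X"
proof -
  obtain F where "piecewise_affine F" "\<forall>y\<in>X. f y = F y"
    using assms by (auto simp: RX_iff_piecewise_affine)
  then have "piecewise_affine (\<lambda>y. \<bar>F y\<bar>)" "\<forall>y\<in>X. \<bar>f y\<bar> = \<bar>F y\<bar>"
    by (auto intro: piecewise_affine_abs)
  then show ?thesis using assms by (auto simp: RX_iff_piecewise_affine RX_outside)
qed

lemma RX_continuous_on:
  assumes "bounded X" "f \<in> RX X"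
  shows "continuous_on X f"
proof -
  obtain F where "piecewise_affine F" "\<forall>y\<in>X. f y = F y"
    using assms by (auto simp: RX_iff_piecewise_affine)
  then show ?thesis
    unfolding piecewise_affine_def using continuous_on_cong continuous_on_subset by (metis subset_UNIV)
qed

lemma riesz_ideal_add:
  "riesz_ideal X J \<Longrightarrow> f \<in> J \<Longrightarrow> g \<in> J \<Longrightarrow> (\<lambda>y. f y + g y) \<in> J"
  by (simp add: riesz_ideal_def)

lemma riesz_ideal_cmult: "riesz_ideal X J \<Longrightarrow> f \<in> J \<Longrightarrow> (\<lambda>y. k * f y) \<in> J"
  by (simp add: riesz_ideal_def)

lemma riesz_ideal_solid:
  assumes "riesz_ideal X J" "f \<in> RX X" "g \<in> J" "\<And>y. \<bar>f y\<bar> \<le> \<bar>g y\<bar>"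
  shows "f \<in> J"
  using assms unfolding riesz_ideal_def by blast

section \<open>Maximal ideals are point ideals\<close>

definition point_ideal :: "'a::euclidean_space set \<Rightarrow> 'a \<Rightarrow> ('a \<Rightarrow> real) set" where
  "point_ideal X z = {f \<in> RX X. f z = 0}"

lemma riesz_ideal_point_ideal:
  assumes "bounded X"
  shows "riesz_ideal X (point_ideal X z)"
  unfolding riesz_ideal_def
proof (intro conjI ballI allI impI)
  show "(\<lambda>y. 0) \<in> point_ideal X z"
    using RX_restrict[OF assms piecewise_affine_affine[of 0 0]] by (simp add: point_ideal_def cong: if_cong)
  show "f \<in> point_ideal X z" if "f \<in> RX X" "g \<in> point_ideal X z" "\<forall>y. \<bar>f y\<bar> \<le> \<bar>g y\<bar>" for f g
  proof -
    have "\<bar>f z\<bar> \<le> \<bar>g z\<bar>" using that(3) by blast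
    moreover have "g z = 0" using that(2) by (simp add: point_ideal_def)
    ultimately show ?thesis using that(1) by (simp add: point_ideal_def)
  qed
qed (use assms in \<open>auto simp: point_ideal_def intro: RX_add RX_cmult\<close>)

text \<open>Vanishing at \<open>z\<close> is a condition of codimension one: if \<open>h\<close> in
  a larger ideal does not vanish at \<open>z\<close>, subtracting a suitable multiple of
  \<open>h\<close> from any \<open>f\<close> gives a function vanishing at \<open>z\<close>.\<close>

lemma maximal_riesz_ideal_point_ideal:
  assumes "bounded X" "z \<in> X"
  shows "maximal_riesz_ideal X (point_ideal X z)"
  unfolding maximal_riesz_ideal_def
proof (intro conjI allI impI)
  show "riesz_ideal X (point_ideal X z)" using assms by (rule_tac riesz_ideal_point_ideal)
  have "(\<lambda>y. if y \<in> X then 1 else 0) \<in> RX X"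
    using RX_restrict[OF assms(1) piecewise_affine_affine[of 0 1]] by (simp cong: if_cong)
  then show "point_ideal X z \<noteq> RX X" using assms(2) 
    unfolding point_ideal_def by (smt (verit) mem_Collect_eq)
  fix J assume J: "riesz_ideal X J \<and> point_ideal X z \<subseteq> J"
  show "J = point_ideal X z \<or> J = RX X"
  proof (cases "J \<subseteq> point_ideal X z")
    case False
    have JX: "J \<subseteq> RX X" using J by (auto simp: riesz_ideal_def)
    then obtain h where h: "h \<in> J" "h z \<noteq> 0" using False by (auto simp: point_ideal_def)
    have "f \<in> J" if f: "f \<in> RX X" for f
    proof -
      have hm: "(\<lambda>y. (f z / h z) * h y) \<in> J" using J h(1) by (intro riesz_ideal_cmult) auto
      have "(\<lambda>y. (- (f z / h z)) * h y) \<in> RX X"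
        using h(1) JX by (intro RX_cmult[OF assms(1)]) auto
      then have "(\<lambda>y. f y + (- (f z / h z)) * h y) \<in> RX X"
        by (rule RX_add[OF assms(1) f])
      then have "(\<lambda>y. f y + (- (f z / h z)) * h y) \<in> J"
        using h(2) J by (auto simp: point_ideal_def)
      from riesz_ideal_add[OF conjunct1[OF J] this hm]
      have "(\<lambda>y. (f y + (- (f z / h z)) * h y) + (f z / h z) * h y) \<in> J" .
      then show ?thesis by simp
    qed
    then show ?thesis using JX by blast
  qed (use J in blast)
qed

lemma riesz_ideal_sum_abs:
  assumes "bounded X" "riesz_ideal X J" "finite I" "\<And>i. i \<in> I \<Longrightarrow> h i \<in> J"
  shows "(\<lambda>y. \<Sum>i\<in>I. \<bar>h i y\<bar>) \<in> J"
  using assms(3,4)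
proof (induction rule: finite_induct)
  case empty
  then show ?case using assms(2) by (simp add: riesz_ideal_def)
next
  case (insert i I)
  have hi: "h i \<in> J" "h i \<in> RX X" using insert.prems assms(2) by (auto simp: riesz_ideal_def)
  have "(\<lambda>y. \<bar>h i y\<bar>) \<in> J"
    by (rule riesz_ideal_solid[OF assms(2) RX_abs[OF assms(1) hi(2)] hi(1)]) simp
  moreover have "(\<lambda>y. \<Sum>i\<in>I. \<bar>h i y\<bar>) \<in> J" using insert by blast
  ultimately have "(\<lambda>y. \<bar>h i y\<bar> + (\<Sum>i\<in>I. \<bar>h i y\<bar>)) \<in> J"
    by (rule riesz_ideal_add[OF assms(2)])
  then show ?case using insert.hyps by simp
qed

text \<open>By compactness \<open>h\<close> has a positive minimum, so a constant multiple of
  \<open>h\<close> dominates any given \<open>f\<close>, and solidity puts \<open>f\<close> into the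
  ideal.\<close>

lemma riesz_ideal_eq_RX_if_positive:
  assumes "compact X" "riesz_ideal X J" "h \<in> J" "\<And>y. y \<in> X \<Longrightarrow> h y > 0"
  shows "J = RX X"
proof -
  have bX: "bounded X" by (rule compact_imp_bounded[OF assms(1)])
  have JX: "J \<subseteq> RX X" using assms(2) by (simp add: riesz_ideal_def)
  have "f \<in> J" if f: "f \<in> RX X" for f
  proof (cases "X = {}")
    case True
    then have "f = (\<lambda>y. 0)" using RX_outside[OF f] by auto
    then show ?thesis using assms(2) by (simp add: riesz_ideal_def)
  next
    case False
    obtain x where x: "x \<in> X" "\<And>y. y \<in> X \<Longrightarrow> h x \<le> h y"
      using continuous_attains_inf[OF assms(1) False RX_continuous_on[OF bX]] assms(3) JX by blast
    have "compact (f ` X)" using compact_continuous_image[OF RX_continuous_on[OF bX f] assms(1)] .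
    then obtain B where B: "B > 0" "\<And>y. y \<in> X \<Longrightarrow> \<bar>f y\<bar> \<le> B"
      using compact_imp_bounded[of "f ` X"] by (auto simp: bounded_pos)
    have hx: "h x > 0" using assms(4) x(1) .
    have "\<bar>f y\<bar> \<le> \<bar>(B / h x) * h y\<bar>" for y
    proof (cases "y \<in> X")
      case True
      have "\<bar>f y\<bar> \<le> (B / h x) * h x" using B(2)[OF True] hx by simp
      also have "\<dots> \<le> (B / h x) * h y" using x(2)[OF True] B(1) hx by (intro mult_left_mono) auto
      finally show ?thesis by linarith
    qed (use f RX_outside in force)
    moreover have "(\<lambda>y. (B / h x) * h y) \<in> J" by (rule riesz_ideal_cmult[OF assms(2,3)])
    ultimately show ?thesis by (rule riesz_ideal_solid[OF assms(2) f, rotated])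
  qed
  then show ?thesis using JX by blast
qed

text \<open>If the functions in \<open>M\<close> had no common zero, then by compactness finitely
  many of them would have none, and the sum of their absolute values would make \<open>M\<close>
  improper. A common zero places \<open>M\<close> inside a point ideal, and maximality gives
  equality.\<close>

lemma maximal_riesz_ideal_imp_point_ideal:
  assumes "compact X" "maximal_riesz_ideal X M"
  obtains z where "z \<in> X" "M = point_ideal X z"
proof -
  have bX: "bounded X" by (rule compact_imp_bounded[OF assms(1)])
  have M: "riesz_ideal X M" "M \<noteq> RX X" and MX: "M \<subseteq> RX X"
    using assms(2) by (auto simp: maximal_riesz_ideal_def riesz_ideal_def)
  have "\<exists>z\<in>X. \<forall>f\<in>M. f z = 0"
  proof (rule ccontr)
    assume "\<not> ?thesis"
    then obtain h where h: "\<And>z. z \<in> X \<Longrightarrow> h z \<in> M" "\<And>z. z \<in> X \<Longrightarrow> h z z \<noteq> 0" by metis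
    have "\<exists>U. open U \<and> U \<inter> X = h z -` (- {0}) \<inter> X" if "z \<in> X" for z
    proof -
      have "continuous_on X (h z)" using RX_continuous_on[OF bX] h(1)[OF that] MX by blast
      moreover have "open (- {0::real})" by auto
      ultimately show ?thesis unfolding continuous_on_open_invariant by blast
    qed
    then obtain U where U: "\<And>z. z \<in> X \<Longrightarrow> open (U z)"
        "\<And>z. z \<in> X \<Longrightarrow> U z \<inter> X = h z -` (- {0}) \<inter> X" by metis
    have "X \<subseteq> (\<Union>z\<in>X. U z)" using U(2) h(2) by blast
    then obtain D where D: "D \<subseteq> X" "finite D" "X \<subseteq> (\<Union>z\<in>D. U z)"
      using compactE_image[OF assms(1), of X U] U(1) by blast
    have "(\<lambda>y. \<Sum>z\<in>D. \<bar>h z y\<bar>) \<in> M"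
      using riesz_ideal_sum_abs[OF bX M(1) D(2)] h(1) D(1) by blast
    moreover have "(\<Sum>z\<in>D. \<bar>h z y\<bar>) > 0" if y: "y \<in> X" for y
    proof -
      obtain z where z: "z \<in> D" "y \<in> U z" using D(3) y by blast
      then have "h z y \<noteq> 0" using U(2)[of z] D(1) y by blast
      then show ?thesis using z(1) D(2) by (intro sum_pos2[of _ z]) auto
    qed
    ultimately show False using riesz_ideal_eq_RX_if_positive[OF assms(1) M(1)] M(2) by blast
  qed
  then obtain z where z: "z \<in> X" "\<forall>f\<in>M. f z = 0" by blast
  then have "M \<subseteq> point_ideal X z" using MX by (auto simp: point_ideal_def)
  moreover have "point_ideal X z \<noteq> RX X" "riesz_ideal X (point_ideal X z)"
    using maximal_riesz_ideal_point_ideal[OF bX z(1)] by (auto simp: maximal_riesz_ideal_def)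
  ultimately have "M = point_ideal X z" using assms(2) unfolding maximal_riesz_ideal_def by blast
  then show thesis using that z(1) by blast
qed

section \<open>Strong semisimplicity and zero sets\<close>

text \<open>As the maximal ideals are the point ideals, those containing \<open>g\<close> belong to
  the zeros of \<open>g\<close> in \<open>X\<close>, and their intersection consists of the
  functions vanishing at these zeros. Since elements of \<open>RX X\<close> are 0 outside
  \<open>X\<close>, the quantifiers may run over the whole space.\<close>

lemma strongly_semisimple_iff_zero_set:
  fixes X :: "'a::euclidean_space set"
  assumes "compact X"
  shows "strongly_semisimple X \<longleftrightarrow>
    (\<forall>f\<in>RX X. \<forall>g\<in>RX X. (\<forall>y. g y = 0 \<longrightarrow> f y = 0) \<longrightarrow> (\<exists>m::nat. \<forall>y. \<bar>f y\<bar> \<le> real m * \<bar>g y\<bar>))"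
    (is "_ \<longleftrightarrow> ?dom")
proof
  assume ss: "strongly_semisimple X"
  show ?dom
  proof (intro ballI impI)
    fix f g assume f: "f \<in> RX X" and g: "g \<in> RX X" and Z: "\<forall>y. g y = 0 \<longrightarrow> f y = 0"
    obtain \<M> where \<M>: "\<forall>M\<in>\<M>. maximal_riesz_ideal X M" "principal_ideal X g = RX X \<inter> \<Inter>\<M>"
      using bspec[OF ss[unfolded strongly_semisimple_def] g] by (elim exE conjE)
    have "g \<in> principal_ideal X g" using g by (auto simp: principal_ideal_def intro!: exI[of _ 1])
    have "f \<in> M" if M: "M \<in> \<M>" for M
    proof -
      obtain z where z: "M = point_ideal X z"
        using maximal_riesz_ideal_imp_point_ideal[OF assms bspec[OF \<M>(1) M]] by blast
      have "g \<in> M" using \<open>g \<in> principal_ideal X g\<close> \<M>(2) M by blast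
      then show ?thesis using f Z by (simp add: z point_ideal_def)
    qed
    then have "f \<in> principal_ideal X g" using \<M>(2) f by blast
    then show "\<exists>m::nat. \<forall>y. \<bar>f y\<bar> \<le> real m * \<bar>g y\<bar>" unfolding principal_ideal_def by blast
  qed
next
  assume dom: ?dom
  have bX: "bounded X" by (rule compact_imp_bounded[OF assms(1)])
  show "strongly_semisimple X"
    unfolding strongly_semisimple_def
  proof (rule ballI, rule exI, rule conjI)
    fix g assume g: "g \<in> RX X"
    \<comment> \<open>These are the maximal ideals containing \<open>g\<close>; if there is none,
      the right-hand side is all of \<open>RX X\<close>.\<close>
    let ?\<M> = "point_ideal X ` {z \<in> X. g z = 0}"
    show "\<forall>M\<in>?\<M>. maximal_riesz_ideal X M"
      using maximal_riesz_ideal_point_ideal[OF bX] by blast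
    show "principal_ideal X g = RX X \<inter> \<Inter>?\<M>"
    proof
      show "principal_ideal X g \<subseteq> RX X \<inter> \<Inter>?\<M>"
      proof
        fix f assume "f \<in> principal_ideal X g"
        then obtain m :: nat where f: "f \<in> RX X" "\<And>y. \<bar>f y\<bar> \<le> real m * \<bar>g y\<bar>"
          by (auto simp: principal_ideal_def)
        have "f z = 0" if "g z = 0" for z using f(2)[of z] that by simp
        then show "f \<in> RX X \<inter> \<Inter>?\<M>" using f(1) by (auto simp: point_ideal_def)
      qed
      show "RX X \<inter> \<Inter>?\<M> \<subseteq> principal_ideal X g"
      proof
        fix f assume f: "f \<in> RX X \<inter> \<Inter>?\<M>"
        have "f z = 0" if "g z = 0" for z
          using f that by (cases "z \<in> X") (auto simp: point_ideal_def RX_outside)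
        then show "f \<in> principal_ideal X g"
          using dom[rule_format, of f g] f g by (simp add: principal_ideal_def)
      qed
    qed
  qed
qed

text \<open>On a cell where \<open>\<bar>f\<bar>\<close> and \<open>\<bar>g\<bar>\<close> are
  affine, bounding the first by a multiple of the second is a linear inequality, so it passes from
  the finitely many generating points to the whole cell. Finitely many cells then give one
  constant.\<close>

lemma polytope_imp_strongly_semisimple:
  fixes X :: "'a::euclidean_space set"
  assumes "polytope X"
  shows "strongly_semisimple X"
proof -
  have cX: "compact X" using assms by (rule polytope_imp_compact)
  have bX: "bounded X" by (rule compact_imp_bounded[OF cX])
  have "\<exists>m::nat. \<forall>y. \<bar>f y\<bar> \<le> real m * \<bar>g y\<bar>"
    if f: "f \<in> RX X" and g: "g \<in> RX X" and Z: "\<forall>y. g y = 0 \<longrightarrow> f y = 0" for f g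
  proof -
    obtain F G where F: "piecewise_affine F" "\<forall>y\<in>X. \<bar>f y\<bar> = F y"
      and G: "piecewise_affine G" "\<forall>y\<in>X. \<bar>g y\<bar> = G y"
      using RX_abs[OF bX f] RX_abs[OF bX g] by (auto simp: RX_iff_piecewise_affine[OF bX])
    \<comment> \<open>Indexing by booleans lets one subdivision serve both functions.\<close>
    have FG: "piecewise_affine (if b then F else G)" for b using F(1) G(1) by simp
    obtain \<G> where \<G>: "finite \<G>" "\<Union>\<G> = X" "\<And>C. C \<in> \<G> \<Longrightarrow> polytope C"
      "\<And>C b. C \<in> \<G> \<Longrightarrow> b \<in> UNIV \<Longrightarrow> \<exists>w c. \<forall>y\<in>C. (if b then F else G) y = w \<bullet> y + c"
      using piecewise_affine_subdivision[OF assms finite[of "UNIV :: bool set"], of "\<lambda>b. if b then F else G"] FG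
      by (smt (verit, best))
    have "\<exists>m::nat. \<forall>y\<in>C. \<bar>f y\<bar> \<le> real m * \<bar>g y\<bar>" if C: "C \<in> \<G>" for C
    proof -
      obtain V where V: "finite V" "C = convex hull V" using \<G>(3)[OF C] by (auto simp: polytope_def)
      have VX: "V \<subseteq> X" using C V(2) \<G>(2) hull_subset[of V convex] by blast
      obtain w c where w: "\<And>y. y \<in> C \<Longrightarrow> \<bar>f y\<bar> = w \<bullet> y + c"
        using \<G>(4)[OF C, of True] F(2) \<G>(2) C by auto
      obtain v d where v: "\<And>y. y \<in> C \<Longrightarrow> \<bar>g y\<bar> = v \<bullet> y + d"
        using \<G>(4)[OF C, of False] G(2) \<G>(2) C by auto
      \<comment> \<open>A multiplier exists at each single point: \<open>f\<close> vanishes where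
        \<open>g\<close> does, and the Archimedean property covers the remaining points.\<close>
      have "\<exists>m::nat. \<bar>f y\<bar> \<le> real m * \<bar>g y\<bar>" for y
      proof (cases "g y = 0")
        case False
        then show ?thesis using reals_Archimedean3[of "\<bar>g y\<bar>"] by (meson less_imp_le zero_less_abs_iff)
      qed (use Z in auto)
      then obtain m :: "'a \<Rightarrow> nat" where m: "\<And>y. \<bar>f y\<bar> \<le> real (m y) * \<bar>g y\<bar>" by metis
      define N where "N = (\<Sum>y\<in>V. m y)"
      have "V \<subseteq> {y. (w - real N *\<^sub>R v) \<bullet> y \<le> real N * d - c}"
      proof
        fix y assume y: "y \<in> V"
        then have "m y \<le> N" unfolding N_def using V(1) by (simp add: member_le_sum)
        then have "\<bar>f y\<bar> \<le> real N * \<bar>g y\<bar>" using m[of y] by (meson abs_ge_zero mult_right_mono of_nat_le_iff order_trans)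
        moreover have "y \<in> C" using y V(2) by (simp add: hull_inc)
        ultimately have "w \<bullet> y + c \<le> real N * (v \<bullet> y + d)" using w v by simp
        then show "y \<in> {y. (w - real N *\<^sub>R v) \<bullet> y \<le> real N * d - c}" by (simp add: algebra_simps)
      qed
      then have "C \<subseteq> {y. (w - real N *\<^sub>R v) \<bullet> y \<le> real N * d - c}"
        unfolding V(2) by (simp add: hull_minimal convex_halfspace_le)
      then have "w \<bullet> y + c \<le> real N * (v \<bullet> y + d)" if "y \<in> C" for y
        using that by (auto simp: algebra_simps)
      then show ?thesis using w v by auto
    qed
    then obtain m :: "'a set \<Rightarrow> nat" where
      m: "\<And>C y. C \<in> \<G> \<Longrightarrow> y \<in> C \<Longrightarrow> \<bar>f y\<bar> \<le> real (m C) * \<bar>g y\<bar>" by metis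
    have "\<bar>f y\<bar> \<le> real (\<Sum>C\<in>\<G>. m C) * \<bar>g y\<bar>" for y
    proof (cases "y \<in> X")
      case True
      then obtain C where C: "C \<in> \<G>" "y \<in> C" using \<G>(2) by blast
      then have "m C \<le> (\<Sum>C\<in>\<G>. m C)" using \<G>(1) by (simp add: member_le_sum)
      then show ?thesis using m[OF C] by (meson abs_ge_zero mult_right_mono of_nat_le_iff order_trans)
    qed (use RX_outside[OF f] in \<open>simp add: sum_nonneg\<close>)
    then show ?thesis by blast
  qed
  then show ?thesis unfolding strongly_semisimple_iff_zero_set[OF cX] by blast
qed

section \<open>Frenet frames\<close>

text \<open>For the simplex with vertices \<open>x\<close>, \<open>x + v 0\<close>,
  \<open>x + v 0 + v 1\<close> and so on, \<open>t j\<close> is the coefficient of the edge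
  \<open>v j\<close>, that is the total weight of the vertices with index above \<open>j\<close>;
  hence the monotonicity.\<close>

definition chain_coeffs :: "nat \<Rightarrow> (nat \<Rightarrow> real) \<Rightarrow> bool" where
  "chain_coeffs m t \<longleftrightarrow> (\<forall>j<m. 0 \<le> t j \<and> t j \<le> 1) \<and> (\<forall>i j. i \<le> j \<longrightarrow> j < m \<longrightarrow> t j \<le> t i)"

lemma chain_coeffs_if_Suc:
  assumes "\<And>j. j < m \<Longrightarrow> 0 \<le> t j" "\<And>j. j < m \<Longrightarrow> t j \<le> 1" "\<And>j. Suc j < m \<Longrightarrow> t (Suc j) \<le> t j"
  shows "chain_coeffs m t"
proof -
  have "j < m \<longrightarrow> t j \<le> t i" if "i \<le> j" for i j
    using that
  proof (induction rule: dec_induct)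
    case (step n)
    then show ?case using assms(3)[of n] by force
  qed simp
  then show ?thesis using assms(1,2) by (simp add: chain_coeffs_def)
qed

text \<open>Induction splits off the last vertex with weight \<open>t m\<close>; the other
  coefficients, reduced by \<open>t m\<close> and rescaled, describe a point of the smaller
  simplex.\<close>

lemma chain_point_in_convex:
  fixes x :: "'a::real_vector"
  assumes "convex S" "\<And>i. i \<le> m \<Longrightarrow> x + (\<Sum>j<i. v j) \<in> S" "chain_coeffs m t"
  shows "x + (\<Sum>j<m. t j *\<^sub>R v j) \<in> S"
  using assms(2,3)
proof (induction m arbitrary: t)
  case 0
  then show ?case by simp
next
  case (Suc m)
  let ?c = "t m"
  have c: "0 \<le> ?c" "?c \<le> 1" and ge: "\<And>j. j < m \<Longrightarrow> ?c \<le> t j" and le: "\<And>j. j < m \<Longrightarrow> t j \<le> 1"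
    using Suc.prems(2) by (auto simp: chain_coeffs_def)
  show ?case
  proof (cases "?c = 1")
    \<comment> \<open>Rescaling would divide by 0 here; monotonicity makes the point the last vertex
      itself.\<close>
    case True
    then have "t j = 1" if "j < Suc m" for j using ge le that by (metis antisym less_Suc_eq)
    then show ?thesis using Suc.prems(1)[of "Suc m"] by simp
  next
    case False
    define s where "s = (\<lambda>j. (t j - ?c) / (1 - ?c))"
    have pos: "1 - ?c > 0" using c False by simp
    have "chain_coeffs m s"
      using Suc.prems(2) pos ge le
      by (auto simp: chain_coeffs_def s_def divide_simps)
    then have q: "x + (\<Sum>j<m. s j *\<^sub>R v j) \<in> S" using Suc by simp
    have "(1 - ?c) *\<^sub>R (\<Sum>j<m. s j *\<^sub>R v j) = (\<Sum>j<m. t j *\<^sub>R v j) - ?c *\<^sub>R (\<Sum>j<m. v j)"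
      using pos by (simp add: scaleR_sum_right s_def sum_subtractf[symmetric] scaleR_diff_left)
    then have "(1 - ?c) *\<^sub>R (x + (\<Sum>j<m. s j *\<^sub>R v j)) + ?c *\<^sub>R (x + (\<Sum>j<Suc m. v j))
        = x + (\<Sum>j<Suc m. t j *\<^sub>R v j)"
      by (simp add: scaleR_add_right algebra_simps)
    moreover have "(1 - ?c) *\<^sub>R (x + (\<Sum>j<m. s j *\<^sub>R v j)) + ?c *\<^sub>R (x + (\<Sum>j<Suc m. v j)) \<in> S"
      by (rule convexD[OF assms(1) q Suc.prems(1)[OF order_refl]]) (use c in auto)
    ultimately show ?thesis by simp
  qed
qed

lemma convex_hull_chain:
  fixes x :: "'a::real_vector"
  shows "convex hull ((\<lambda>i. x + (\<Sum>j<i. v j)) ` {..m}) = {x + (\<Sum>j<m. t j *\<^sub>R v j) |t. chain_coeffs m t}"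
    (is "convex hull ?P = ?R")
proof
  show "convex hull ?P \<subseteq> ?R"
  proof (rule hull_minimal)
    show "?P \<subseteq> ?R"
    proof
      fix y assume "y \<in> ?P"
      then obtain i where i: "i \<le> m" "y = x + (\<Sum>j<i. v j)" by auto
      \<comment> \<open>The vertex with index \<open>i\<close> uses the first \<open>i\<close> edges
        fully and no others.\<close>
      let ?t = "\<lambda>j. if j < i then 1 else 0 :: real"
      have "(\<Sum>j<m. ?t j *\<^sub>R v j) = (\<Sum>j<i. v j)"
        using i(1) by (intro sum.mono_neutral_cong_right) auto
      moreover have "chain_coeffs m ?t" by (auto simp: chain_coeffs_def)
      ultimately show "y \<in> ?R" using i(2) by (intro CollectI exI[of _ ?t]) simp
    qed
    show "convex ?R"
    proof (rule convexI)
      fix y z and a b :: real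
      assume "y \<in> ?R" "z \<in> ?R" and ab: "0 \<le> a" "0 \<le> b" "a + b = 1"
      then obtain s t where s: "y = x + (\<Sum>j<m. s j *\<^sub>R v j)" "chain_coeffs m s"
        and t: "z = x + (\<Sum>j<m. t j *\<^sub>R v j)" "chain_coeffs m t" by blast
      let ?r = "\<lambda>j. a * s j + b * t j"
      have "chain_coeffs m ?r"
        unfolding chain_coeffs_def
      proof (intro conjI allI impI)
        fix i j assume "i \<le> j" "j < m"
        then show "?r j \<le> ?r i"
          using s(2) t(2) ab unfolding chain_coeffs_def by (intro add_mono mult_left_mono) auto
      next
        fix j assume j: "j < m"
        then show "0 \<le> ?r j" using s(2) t(2) ab by (simp add: chain_coeffs_def)
        show "?r j \<le> 1"
          using convex_bound_le[of "s j" 1 "t j" a b] s(2) t(2) ab j by (simp add: chain_coeffs_def)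
      qed
      moreover have "a *\<^sub>R y + b *\<^sub>R z = (a + b) *\<^sub>R x + (\<Sum>j<m. ?r j *\<^sub>R v j)"
        by (simp add: s(1) t(1) scaleR_sum_right sum.distrib algebra_simps)
      ultimately show "a *\<^sub>R y + b *\<^sub>R z \<in> ?R" using ab(3) by (intro CollectI exI[of _ ?r]) simp
    qed
  qed
  show "?R \<subseteq> convex hull ?P"
  proof
    fix y assume "y \<in> ?R"
    then obtain t where t: "y = x + (\<Sum>j<m. t j *\<^sub>R v j)" "chain_coeffs m t" by blast
    show "y \<in> convex hull ?P"
      unfolding t(1) by (rule chain_point_in_convex[OF convex_convex_hull _ t(2)]) (auto intro: hull_inc)
  qed
qed

section \<open>Building and extending frames\<close>

text \<open>The frame may be empty here, so that frames can be built up starting from the empty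
  list.\<close>

definition frenet_system :: "(nat \<Rightarrow> 'a::euclidean_space) \<Rightarrow> 'a \<Rightarrow> 'a list \<Rightarrow> bool" where
  "frenet_system xs x us \<longleftrightarrow> xs \<longlonglongrightarrow> x \<and> (\<forall>i. xs i \<noteq> x) \<and>
     (\<forall>j<length us. norm (us ! j) = 1) \<and>
     (\<forall>j<length us. \<forall>l<length us. j \<noteq> l \<longrightarrow> (us ! j) \<bullet> (us ! l) = 0) \<and>
     (\<forall>k<length us. (\<forall>i. frenet_residual us k x (xs i) \<noteq> 0) \<and>
        (\<lambda>i. (1 / norm (frenet_residual us k x (xs i))) *\<^sub>R frenet_residual us k x (xs i))
          \<longlonglongrightarrow> us ! k)"

lemma frenet_frame_iff_system: "frenet_frame xs x us \<longleftrightarrow> us \<noteq> [] \<and> frenet_system xs x us"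
  by (auto simp: frenet_frame_def frenet_system_def)

lemma frenet_residual_cong:
  assumes "\<And>j. j < k \<Longrightarrow> us ! j = vs ! j"
  shows "frenet_residual us k x y = frenet_residual vs k x y"
  using assms by (simp add: frenet_residual_def)

lemma frenet_system_take:
  assumes "frenet_system xs x us"
  shows "frenet_system xs x (take k us)"
proof -
  have "frenet_residual (take k us) j x y = frenet_residual us j x y" if "j < k" for j y
    using that by (intro frenet_residual_cong) simp
  then show ?thesis using assms by (simp add: frenet_system_def)
qed

lemma frenet_system_subseq:
  fixes xs :: "nat \<Rightarrow> 'a::euclidean_space"
  assumes "frenet_system xs x us" "strict_mono r"
  shows "frenet_system (xs \<circ> r) x us"
proof -
  have "(\<lambda>i. Y (r i)) \<longlonglongrightarrow> u" if "Y \<longlonglongrightarrow> u" for Y :: "nat \<Rightarrow> 'a" and u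
    using LIMSEQ_subseq_LIMSEQ[OF that assms(2)] by (simp add: comp_def)
  from this[of "\<lambda>i. (1 / norm (frenet_residual us k x (xs i))) *\<^sub>R frenet_residual us k x (xs i)" for k]
  have "(\<lambda>i. (1 / norm (frenet_residual us k x (xs (r i)))) *\<^sub>R frenet_residual us k x (xs (r i)))
      \<longlonglongrightarrow> us ! k" if "k < length us" for k
    using assms(1) that by (simp add: frenet_system_def)
  then show ?thesis
    using assms(1) LIMSEQ_subseq_LIMSEQ[OF _ assms(2), of xs x] by (simp add: frenet_system_def comp_def)
qed

lemma frenet_residual_orthogonal:
  assumes "frenet_system xs x us" "l < k" "k \<le> length us"
  shows "frenet_residual us k x y \<bullet> (us ! l) = 0"
proof -
  have "(\<Sum>j<k. ((y - x) \<bullet> (us ! j)) *\<^sub>R (us ! j)) \<bullet> (us ! l) =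
      (\<Sum>j<k. if j = l then (y - x) \<bullet> (us ! l) else 0)"
    unfolding inner_sum_left
  proof (rule sum.cong)
    fix j assume "j \<in> {..<k}"
    moreover have "us ! l \<bullet> us ! l = 1" using assms by (simp add: frenet_system_def dot_square_norm)
    ultimately show "((y - x) \<bullet> (us ! j)) *\<^sub>R (us ! j) \<bullet> (us ! l) = (if j = l then (y - x) \<bullet> (us ! l) else 0)"
      using assms by (auto simp: frenet_system_def)
  qed simp
  then show ?thesis using assms(2) by (simp add: frenet_residual_def inner_diff_left)
qed

text \<open>Normalised residuals lie on the compact unit sphere, so a subsequence converges; the
  limit inherits orthogonality to the earlier vectors from the residuals.\<close>

lemma frenet_system_extend:
  fixes xs :: "nat \<Rightarrow> 'a::euclidean_space"
  assumes fs: "frenet_system xs x us"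
    and ne: "\<And>i. frenet_residual us (length us) x (xs i) \<noteq> 0"
  obtains r u where "strict_mono r" "frenet_system (xs \<circ> r) x (us @ [u])"
proof -
  define N where "N = (\<lambda>i. (1 / norm (frenet_residual us (length us) x (xs i))) *\<^sub>R
      frenet_residual us (length us) x (xs i))"
  have "N i \<in> sphere 0 1" for i using ne[of i] by (simp add: N_def)
  then obtain u r where ur: "u \<in> sphere 0 1" "strict_mono r" "(N \<circ> r) \<longlonglongrightarrow> u"
    using compact_sphere[of "0::'a" 1] unfolding compact_def by meson
  have orth: "u \<bullet> (us ! l) = 0" if "l < length us" for l
  proof -
    have "N i \<bullet> (us ! l) = 0" for i
      using frenet_residual_orthogonal[OF fs that] by (simp add: N_def)
    then have "(\<lambda>i. (N \<circ> r) i \<bullet> (us ! l)) \<longlonglongrightarrow> 0" by simp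
    moreover have "(\<lambda>i. (N \<circ> r) i \<bullet> (us ! l)) \<longlonglongrightarrow> u \<bullet> (us ! l)"
      by (intro tendsto_intros ur(3))
    ultimately show ?thesis using LIMSEQ_unique by blast
  qed
  have res: "frenet_residual (us @ [u]) j x y = frenet_residual us j x y" if "j \<le> length us" for j y
    using that by (intro frenet_residual_cong) (simp add: nth_append)
  have fs': "frenet_system (xs \<circ> r) x us" by (rule frenet_system_subseq[OF fs ur(2)])
  have "frenet_system (xs \<circ> r) x (us @ [u])"
    unfolding frenet_system_def
  proof (intro conjI allI impI)
    show "(xs \<circ> r) \<longlonglongrightarrow> x" "(xs \<circ> r) i \<noteq> x" for i using fs' by (auto simp: frenet_system_def)
    show "norm ((us @ [u]) ! j) = 1" if "j < length (us @ [u])" for j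
      using that fs' ur(1) by (auto simp: frenet_system_def nth_append)
    show "(us @ [u]) ! j \<bullet> (us @ [u]) ! l = 0"
      if "j < length (us @ [u])" "l < length (us @ [u])" "j \<noteq> l" for j l
      using that fs' orth by (auto simp: frenet_system_def nth_append inner_commute)
    show "frenet_residual (us @ [u]) k x ((xs \<circ> r) i) \<noteq> 0" if "k < length (us @ [u])" for k i
      using that fs' ne by (cases "k = length us") (auto simp: frenet_system_def res)
    show "(\<lambda>i. (1 / norm (frenet_residual (us @ [u]) k x ((xs \<circ> r) i))) *\<^sub>R
        frenet_residual (us @ [u]) k x ((xs \<circ> r) i)) \<longlonglongrightarrow> (us @ [u]) ! k"
      if "k < length (us @ [u])" for k
    proof (cases "k = length us")
      case True
      then show ?thesis using ur(3) by (simp add: res N_def comp_def)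
    next
      case False
      then show ?thesis using that fs' by (simp add: frenet_system_def res nth_append)
    qed
  qed
  then show thesis using that ur(2) by blast
qed

text \<open>Orthonormal vectors are independent. The bound allows a frame of greatest length to be
  chosen.\<close>

lemma frenet_system_length_le:
  fixes xs :: "nat \<Rightarrow> 'a::euclidean_space"
  assumes fs: "frenet_system xs x us"
  shows "length us \<le> DIM('a)"
proof -
  have one: "us ! j \<bullet> us ! j = 1" if "j < length us" for j
    using fs that by (simp add: frenet_system_def dot_square_norm)
  have "distinct us"
    unfolding distinct_conv_nth using fs one by (metis frenet_system_def zero_neq_one)
  moreover have "pairwise orthogonal (set us)"
  proof (rule pairwiseI)
    fix a b assume "a \<in> set us" "b \<in> set us" "a \<noteq> b"
    then obtain j l where "j < length us" "l < length us" "j \<noteq> l" "a = us ! j" "b = us ! l"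
      unfolding in_set_conv_nth by blast
    then show "orthogonal a b" using fs by (simp add: frenet_system_def orthogonal_def)
  qed
  moreover have "0 \<notin> set us" using one by (force simp: in_set_conv_nth)
  ultimately have "card (set us) \<le> DIM('a)"
    by (intro independent_card_le pairwise_orthogonal_independent)
  then show ?thesis using \<open>distinct us\<close> by (simp add: distinct_card)
qed

section \<open>Orders of the coordinates along a sequence with a frame\<close>

text \<open>The component of the residual along \<open>us ! j\<close> is the \<open>j\<close>-th
  coordinate of \<open>xs i - x\<close>, because the subtracted terms are orthogonal to
  \<open>us ! j\<close>; the normalised residual tends to the unit vector
  \<open>us ! j\<close>.\<close>

lemma frenet_coordinate_residual_ratio:
  assumes fs: "frenet_system xs x us" and j: "j < length us"
  shows "(\<lambda>i. ((xs i - x) \<bullet> (us ! j)) / norm (frenet_residual us j x (xs i))) \<longlonglongrightarrow> 1"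
proof -
  let ?R = "\<lambda>i. frenet_residual us j x (xs i)"
  have "?R i \<bullet> (us ! j) = (xs i - x) \<bullet> (us ! j)" for i
  proof -
    have "(\<Sum>l<j. ((xs i - x) \<bullet> (us ! l)) *\<^sub>R (us ! l)) \<bullet> (us ! j) = 0"
      unfolding inner_sum_left using fs j by (intro sum.neutral) (auto simp: frenet_system_def)
    then show ?thesis by (simp add: frenet_residual_def inner_diff_left)
  qed
  moreover have "(\<lambda>i. ((1 / norm (?R i)) *\<^sub>R ?R i) \<bullet> (us ! j)) \<longlonglongrightarrow> us ! j \<bullet> us ! j"
    using fs j by (intro tendsto_intros) (simp add: frenet_system_def)
  moreover have "us ! j \<bullet> us ! j = 1" using fs j by (simp add: frenet_system_def dot_square_norm)
  ultimately show ?thesis by simp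
qed

lemma frenet_coordinate_pos:
  assumes fs: "frenet_system xs x us" and j: "j < length us"
  shows "\<forall>\<^sub>F i in sequentially. (xs i - x) \<bullet> (us ! j) > 0"
proof -
  have "\<forall>\<^sub>F i in sequentially. ((xs i - x) \<bullet> (us ! j)) / norm (frenet_residual us j x (xs i)) > 0"
    using order_tendstoD(1)[OF frenet_coordinate_residual_ratio[OF assms]] by simp
  then show ?thesis
    by eventually_elim (simp add: zero_less_divide_iff)
qed

text \<open>Removing the \<open>j\<close>-th component from the normalised \<open>j\<close>-th
  residual leaves a sequence tending to \<open>us ! j - us ! j\<close>. Thus the next residual is of
  smaller order than the \<open>j\<close>-th, whose norm is asymptotic to the \<open>j\<close>-th
  coordinate.\<close>

lemma frenet_residual_coordinate_ratio:
  assumes fs: "frenet_system xs x us" and j: "j < length us"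
  shows "(\<lambda>i. norm (frenet_residual us (Suc j) x (xs i)) / ((xs i - x) \<bullet> (us ! j))) \<longlonglongrightarrow> 0"
proof -
  let ?R = "\<lambda>k i. frenet_residual us k x (xs i)" and ?a = "\<lambda>i. (xs i - x) \<bullet> (us ! j)"
  have ne: "?R j i \<noteq> 0" for i using fs j by (simp add: frenet_system_def)
  have "(\<lambda>i. (1 / norm (?R j i)) *\<^sub>R ?R j i - (?a i / norm (?R j i)) *\<^sub>R us ! j) \<longlonglongrightarrow> us ! j - 1 *\<^sub>R us ! j"
    using fs j frenet_coordinate_residual_ratio[OF assms]
    by (intro tendsto_intros) (simp_all add: frenet_system_def)
  moreover have "(1 / norm (?R j i)) *\<^sub>R ?R j i - (?a i / norm (?R j i)) *\<^sub>R us ! j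
      = (1 / norm (?R j i)) *\<^sub>R ?R (Suc j) i" for i
  proof -
    have "?R (Suc j) i = ?R j i - ?a i *\<^sub>R us ! j" by (simp add: frenet_residual_def)
    then show ?thesis by (simp add: scaleR_diff_right)
  qed
  ultimately have "(\<lambda>i. (1 / norm (?R j i)) *\<^sub>R ?R (Suc j) i) \<longlonglongrightarrow> 0" by simp
  then have "(\<lambda>i. norm ((1 / norm (?R j i)) *\<^sub>R ?R (Suc j) i)) \<longlonglongrightarrow> 0" by (rule tendsto_norm_zero)
  then have "(\<lambda>i. norm ((1 / norm (?R j i)) *\<^sub>R ?R (Suc j) i) / (?a i / norm (?R j i))) \<longlonglongrightarrow> 0 / 1"
    by (rule tendsto_divide[OF _ frenet_coordinate_residual_ratio[OF assms]]) simp
  moreover have "norm ((1 / norm (?R j i)) *\<^sub>R ?R (Suc j) i) / (?a i / norm (?R j i))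
      = norm (?R (Suc j) i) / ?a i" for i
    using ne by simp
  ultimately show ?thesis by (simp only: div_0)
qed

text \<open>The norm of the intermediate residual cancels: it is asymptotic to the next coordinate
  and of smaller order than the current one.\<close>

lemma frenet_coordinate_ratio:
  assumes fs: "frenet_system xs x us" and j: "Suc j < length us"
  shows "(\<lambda>i. ((xs i - x) \<bullet> (us ! Suc j)) / ((xs i - x) \<bullet> (us ! j))) \<longlonglongrightarrow> 0"
proof -
  let ?n = "\<lambda>i. norm (frenet_residual us (Suc j) x (xs i))"
  have "(\<lambda>i. (((xs i - x) \<bullet> (us ! Suc j)) / ?n i) * (?n i / ((xs i - x) \<bullet> (us ! j)))) \<longlonglongrightarrow> 1 * 0"
    using j by (intro tendsto_mult frenet_coordinate_residual_ratio[OF fs]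
        frenet_residual_coordinate_ratio[OF fs]) auto
  moreover have "?n i \<noteq> 0" for i using fs j by (simp add: frenet_system_def)
  ultimately show ?thesis by simp
qed

text \<open>The coordinates of \<open>xs i - x\<close> decay at strictly decreasing orders, so after division by the
  \<open>lam j\<close> they are eventually the coefficients of a point of the simplex.\<close>
lemma frenet_projection_eventually_in_convex:
  fixes xs :: "nat \<Rightarrow> 'a::euclidean_space"
  assumes fs: "frenet_system xs x us" and lam: "\<And>j. j < length us \<Longrightarrow> lam j > 0" and "convex S"
    and S: "\<And>i. i \<le> length us \<Longrightarrow> x + (\<Sum>j<i. lam j *\<^sub>R (us ! j)) \<in> S" and "c > 0"
  shows "\<forall>\<^sub>F i in sequentially. x + c *\<^sub>R (\<Sum>j<length us. ((xs i - x) \<bullet> (us ! j)) *\<^sub>R (us ! j)) \<in> S"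
proof -
  let ?k = "length us" and ?a = "\<lambda>j i. (xs i - x) \<bullet> (us ! j)"
  have "\<forall>\<^sub>F i in sequentially. \<forall>j\<in>{..<?k}. ?a j i > 0"
    using frenet_coordinate_pos[OF fs] by (intro eventually_ball_finite) auto
  moreover have "\<forall>\<^sub>F i in sequentially. \<forall>j\<in>{..<?k}. ?a j i < lam j / c"
  proof (intro eventually_ball_finite ballI)
    fix j assume "j \<in> {..<?k}"
    then have "0 < lam j / c" using lam \<open>c > 0\<close> by simp
    moreover have "xs \<longlonglongrightarrow> x" using fs by (simp add: frenet_system_def)
    then have "(\<lambda>i. ?a j i) \<longlonglongrightarrow> (x - x) \<bullet> (us ! j)" by (intro tendsto_intros)
    ultimately show "\<forall>\<^sub>F i in sequentially. ?a j i < lam j / c"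
      using order_tendstoD(2) by fastforce
  qed simp
  \<comment> \<open>The range stops at \<open>?k - 1\<close> so that \<open>Suc j\<close> is still a
    frame index; for frames of length at most 1 there is nothing to compare.\<close>
  moreover have "\<forall>\<^sub>F i in sequentially. \<forall>j\<in>{..<?k - 1}. ?a (Suc j) i / ?a j i < lam (Suc j) / lam j"
  proof (intro eventually_ball_finite ballI)
    fix j assume "j \<in> {..<?k - 1}"
    then have j: "Suc j < ?k" by simp
    then have "0 < lam (Suc j) / lam j" using lam by simp
    then show "\<forall>\<^sub>F i in sequentially. ?a (Suc j) i / ?a j i < lam (Suc j) / lam j"
      using order_tendstoD(2)[OF frenet_coordinate_ratio[OF fs j]] by blast
  qed simp
  ultimately show ?thesis
  proof eventually_elim
    case (elim i)
    \<comment> \<open>The factor \<open>c\<close> cancels when consecutive coefficients are compared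
      and matters only for the bound \<open>?t j \<le> 1\<close>. It is 1 for the projection itself
      and 2 for the point twice as far from \<open>x\<close>.\<close>
    let ?t = "\<lambda>j. c * ?a j i / lam j"
    have "chain_coeffs ?k ?t"
    proof (rule chain_coeffs_if_Suc)
      fix j assume j: "j < ?k"
      then show "0 \<le> ?t j" using elim(1) lam \<open>c > 0\<close> by (simp add: less_imp_le)
      show "?t j \<le> 1" using elim(2) lam[OF j] \<open>c > 0\<close> j
        by (simp add: pos_less_divide_eq mult.commute less_imp_le)
    next
      fix j assume j: "Suc j < ?k"
      then have "?a (Suc j) i / ?a j i < lam (Suc j) / lam j" "?a j i > 0" "lam j > 0" "lam (Suc j) > 0"
        using elim(1,3) lam by auto
      then have "?a (Suc j) i / lam (Suc j) \<le> ?a j i / lam j" by (simp add: field_simps)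
      then show "?t (Suc j) \<le> ?t j" using \<open>c > 0\<close>
        by (metis mult_left_mono less_imp_le times_divide_eq_right)
    qed
    then have "x + (\<Sum>j<?k. ?t j *\<^sub>R (lam j *\<^sub>R (us ! j))) \<in> S"
      using chain_point_in_convex[OF \<open>convex S\<close>, of ?k x "\<lambda>j. lam j *\<^sub>R (us ! j)"] S by blast
    moreover have "(\<Sum>j<?k. ?t j *\<^sub>R (lam j *\<^sub>R (us ! j))) = c *\<^sub>R (\<Sum>j<?k. ?a j i *\<^sub>R (us ! j))"
      unfolding scaleR_sum_right using lam by (intro sum.cong) (auto simp: less_imp_neq[symmetric] dest!: lam)
    ultimately show ?case by simp
  qed
qed

section \<open>Outgoing tangents\<close>

text \<open>The distance to \<open>C\<close> is not piecewise affine in general. The sum of the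
  violations of finitely many defining inequalities is, and Cauchy-Schwarz bounds it by a multiple
  of the distance to any point of \<open>C\<close>.\<close>

lemma polytope_vanishing_function:
  fixes C :: "'a::euclidean_space set"
  assumes "polytope C"
  obtains G L where "piecewise_affine G" "\<And>y. G y = 0 \<longleftrightarrow> y \<in> C" "L > 0"
    "\<And>y z. z \<in> C \<Longrightarrow> \<bar>G y\<bar> \<le> L * norm (y - z)"
proof -
  obtain H where H: "finite H" "C = \<Inter>H" "\<forall>h\<in>H. \<exists>a b. a \<noteq> 0 \<and> h = {y. a \<bullet> y \<le> b}"
    using polytope_imp_polyhedron[OF assms] unfolding polyhedron_def by blast
  then obtain a b where ab: "\<And>h. h \<in> H \<Longrightarrow> h = {y. a h \<bullet> y \<le> b h}" by metis
  define G where "G = (\<lambda>y. \<Sum>h\<in>H. max 0 (a h \<bullet> y - b h))"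
  define L where "L = 1 + (\<Sum>h\<in>H. norm (a h))"
  show thesis
  proof
    have "piecewise_affine (\<lambda>y. a h \<bullet> y - b h)" for h
      using piecewise_affine_affine[of "a h" "- b h"] by simp
    then show "piecewise_affine G"
      unfolding G_def by (intro piecewise_affine_sum H(1) piecewise_affine_pos_part)
    show "G y = 0 \<longleftrightarrow> y \<in> C" for y
    proof -
      have "G y = 0 \<longleftrightarrow> (\<forall>h\<in>H. max 0 (a h \<bullet> y - b h) = 0)"
        unfolding G_def by (rule sum_nonneg_eq_0_iff) (auto simp: H(1))
      also have "\<dots> \<longleftrightarrow> (\<forall>h\<in>H. y \<in> {y. a h \<bullet> y \<le> b h})" by (auto simp: max_def)
      also have "\<dots> \<longleftrightarrow> y \<in> C" using ab H(2) by blast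
      finally show ?thesis .
    qed
    show "L > 0" unfolding L_def by (simp add: add_pos_nonneg sum_nonneg)
    show "\<bar>G y\<bar> \<le> L * norm (y - z)" if z: "z \<in> C" for y z
    proof -
      have "max 0 (a h \<bullet> y - b h) \<le> norm (a h) * norm (y - z)" if "h \<in> H" for h
      proof -
        have "a h \<bullet> z \<le> b h" using ab[OF that] z H(2) that by blast
        then have "a h \<bullet> y - b h \<le> a h \<bullet> (y - z)" by (simp add: inner_diff_right)
        also have "\<dots> \<le> norm (a h) * norm (y - z)" by (rule norm_cauchy_schwarz)
        finally show ?thesis by simp
      qed
      then have "G y \<le> (\<Sum>h\<in>H. norm (a h) * norm (y - z))" unfolding G_def by (rule sum_mono)
      also have "\<dots> \<le> L * norm (y - z)" by (simp add: L_def sum_distrib_right distrib_right)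
      finally show ?thesis by (simp add: G_def sum_nonneg)
    qed
  qed
qed

text \<open>The affine function \<open>F\<close> measures the last frame coordinate, whereas
  \<open>G\<close> is at most a constant times the residual beyond the frame, which is of smaller
  order along the sequence. The equality of \<open>C\<close> and \<open>C'\<close> inside
  \<open>X\<close> makes \<open>F\<close> vanish at the zeros of \<open>G\<close> in
  \<open>X\<close>, so the zero set criterion would force a domination that fails.\<close>

lemma strongly_semisimple_imp_no_outgoing_tangent:
  fixes X :: "'a::euclidean_space set"
  assumes "compact X" "strongly_semisimple X"
  shows "\<not> outgoing_tangent X x us"
proof
  assume out: "outgoing_tangent X x us"
  have bX: "bounded X" by (rule compact_imp_bounded[OF assms(1)])
  obtain xs where xs: "\<And>i. xs i \<in> X" and "frenet_frame xs x us"
    using out by (auto simp: outgoing_tangent_def tangent_def)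
  then have fs: "frenet_system xs x us" and "us \<noteq> []" by (auto simp: frenet_frame_iff_system)
  then obtain m where m: "length us = Suc m" by (metis length_0_conv not0_implies_Suc)
  obtain lam where lam: "\<And>j. j < length us \<Longrightarrow> lam j > 0"
    and eq: "convex hull ((\<lambda>i. x + (\<Sum>j<i. lam j *\<^sub>R (us ! j))) ` {..length us}) \<inter> X =
      convex hull ((\<lambda>i. x + (\<Sum>j<i. lam j *\<^sub>R (us ! j))) ` {..<length us}) \<inter> X"
    using out unfolding outgoing_tangent_def Let_def by blast
  define C where "C = convex hull ((\<lambda>i. x + (\<Sum>j<i. lam j *\<^sub>R (us ! j))) ` {..length us})"
  define C' where "C' = convex hull ((\<lambda>i. x + (\<Sum>j<i. lam j *\<^sub>R (us ! j))) ` {..m})"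
  have CC': "C \<inter> X = C' \<inter> X" using eq by (simp add: C_def C'_def m lessThan_Suc_atMost)
  have "polytope C" unfolding C_def polytope_def by blast
  then obtain G L where G: "piecewise_affine G" "\<And>y. G y = 0 \<longleftrightarrow> y \<in> C" "L > 0"
    "\<And>y z. z \<in> C \<Longrightarrow> \<bar>G y\<bar> \<le> L * norm (y - z)"
    using polytope_vanishing_function by blast
  define F where "F = (\<lambda>y. us ! m \<bullet> y + - (us ! m \<bullet> x))"
  have F0: "F y = 0" if y: "y \<in> C'" for y
  proof -
    obtain t where "y = x + (\<Sum>j<m. t j *\<^sub>R (lam j *\<^sub>R (us ! j)))"
      using y unfolding C'_def convex_hull_chain by blast
    \<comment> \<open>All edges of \<open>C'\<close> are multiples of earlier frame vectors, which
      are orthogonal to the last one.\<close>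
    moreover have "us ! m \<bullet> (\<Sum>j<m. t j *\<^sub>R (lam j *\<^sub>R (us ! j))) = 0"
      unfolding inner_sum_right using fs m by (intro sum.neutral) (auto simp: frenet_system_def)
    ultimately show ?thesis by (simp add: F_def inner_add_right)
  qed
  let ?f = "\<lambda>y. if y \<in> X then F y else 0" and ?g = "\<lambda>y. if y \<in> X then G y else 0"
  have "?f \<in> RX X" "?g \<in> RX X"
    using bX G(1) piecewise_affine_affine[of "us ! m" "- (us ! m \<bullet> x)"]
    by (auto intro!: RX_restrict simp: F_def)
  moreover have "\<forall>y. ?g y = 0 \<longrightarrow> ?f y = 0" using G(2) F0 CC' by auto
  ultimately obtain M :: nat where M: "\<forall>y. \<bar>?f y\<bar> \<le> real M * \<bar>?g y\<bar>"
    using assms(2)[unfolded strongly_semisimple_iff_zero_set[OF assms(1)], rule_format, of ?f ?g] by blast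
  let ?a = "\<lambda>i. (xs i - x) \<bullet> (us ! m)"
  have "convex C" by (simp add: C_def)
  have "\<forall>\<^sub>F i in sequentially. x + 1 *\<^sub>R (\<Sum>j<length us. ((xs i - x) \<bullet> (us ! j)) *\<^sub>R (us ! j)) \<in> C"
    by (rule frenet_projection_eventually_in_convex[OF fs lam \<open>convex C\<close>])
      (auto simp: C_def intro: hull_inc)
  moreover have "\<forall>\<^sub>F i in sequentially. ?a i > 0" using frenet_coordinate_pos[OF fs] m by simp
  \<comment> \<open>With n the norm of this residual, domination will give
    \<open>?a i \<le> real M * L * n\<close>, while this bound gives
    \<open>n * (real M * L + 1) < ?a i\<close>. The added 1 keeps the denominator positive.\<close>
  moreover have "\<forall>\<^sub>F i in sequentially. norm (frenet_residual us (Suc m) x (xs i)) / ?a i < 1 / (real M * L + 1)"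
    using m G(3) by (intro order_tendstoD(2)[OF frenet_residual_coordinate_ratio[OF fs]]) (auto simp: add_nonneg_pos)
  ultimately have "\<forall>\<^sub>F i in sequentially. False"
  proof eventually_elim
    case (elim i)
    let ?z = "x + (\<Sum>j<length us. ((xs i - x) \<bullet> (us ! j)) *\<^sub>R (us ! j))"
    let ?n = "norm (frenet_residual us (Suc m) x (xs i))"
    \<comment> \<open>The residual beyond the full frame is the difference between
      \<open>xs i\<close> and its projection \<open>?z\<close>, a point of \<open>C\<close>.\<close>
    have "norm (xs i - ?z) = ?n" by (simp add: frenet_residual_def m algebra_simps)
    then have "\<bar>G (xs i)\<bar> \<le> L * ?n" using G(4)[of ?z "xs i"] elim(1) by simp
    then have "real M * \<bar>G (xs i)\<bar> \<le> real M * (L * ?n)" by (intro mult_left_mono) auto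
    moreover have "\<bar>F (xs i)\<bar> \<le> real M * \<bar>G (xs i)\<bar>" using M[rule_format, of "xs i"] xs[of i] by simp
    moreover have "F (xs i) = ?a i" by (simp add: F_def inner_diff_right inner_commute[of _ "us ! m"])
    ultimately have "?a i \<le> real M * L * ?n" by simp
    moreover have "real M * L + 1 > 0" using G(3) by (simp add: add_nonneg_pos)
    then have "?n * (real M * L + 1) < ?a i" using elim(2,3) by (simp add: field_simps)
    ultimately show False by (simp add: algebra_simps) (smt (verit) norm_ge_zero)
  qed
  then show False by simp
qed

text \<open>A point witnessing that the next initial segment is not outgoing has positive coordinates
  along it; these become the new edge lengths.\<close>
lemma no_outgoing_tangent_imp_simplex:
  fixes X :: "'a::euclidean_space set"
  assumes "closed X" "convex X" and fs: "frenet_system xs x us" and xs: "\<And>i. xs i \<in> X"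
    and no: "\<And>us. \<not> outgoing_tangent X x us" and "m \<le> length us"
  shows "\<exists>lam. (\<forall>j<m. lam j > 0) \<and> (\<forall>i\<le>m. x + (\<Sum>j<i. lam j *\<^sub>R (us ! j)) \<in> X)"
  using \<open>m \<le> length us\<close>
proof (induction m)
  case 0
  have "x \<in> X" using fs xs \<open>closed X\<close> closed_sequentially by (auto simp: frenet_system_def)
  then show ?case by simp
next
  case (Suc m)
  then obtain lam0 where lam0: "\<forall>j<m. lam0 j > 0" "\<forall>i\<le>m. x + (\<Sum>j<i. lam0 j *\<^sub>R (us ! j)) \<in> X"
    by auto
  \<comment> \<open>The new length 1 is provisional; the witness found below rescales all
    lengths.\<close>
  define lam where "lam = lam0(m := 1 :: real)"
  have lam: "\<forall>j<Suc m. lam j > 0" using lam0(1) by (auto simp: lam_def less_Suc_eq)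
  have lamX: "x + (\<Sum>j<i. lam j *\<^sub>R (us ! j)) \<in> X" if "i \<le> m" for i
    using lam0(2) that by (simp add: lam_def)
  let ?vs = "take (Suc m) us"
  let ?p = "\<lambda>i. x + (\<Sum>j<i. lam j *\<^sub>R (us ! j))" and ?q = "\<lambda>i. x + (\<Sum>j<i. lam j *\<^sub>R (?vs ! j))"
  have len: "length ?vs = Suc m" using Suc.prems by simp
  have "tangent X x ?vs"
    unfolding tangent_def frenet_frame_iff_system
    using frenet_system_take[OF fs, of "Suc m"] len xs by (metis list.size(3) nat.distinct(1))
  then have "convex hull (?q ` {..Suc m}) \<inter> X \<noteq> convex hull (?q ` {..<Suc m}) \<inter> X"
    using no[of ?vs] lam unfolding outgoing_tangent_def len Let_def by blast
  moreover have "?q ` {..Suc m} = ?p ` {..Suc m}" "?q ` {..<Suc m} = ?p ` {..m}"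
    by (intro image_cong; auto)+
  ultimately have "convex hull (?p ` {..Suc m}) \<inter> X \<noteq> convex hull (?p ` {..m}) \<inter> X"
    by (simp only: not_False_eq_True)
  moreover have "convex hull (?p ` {..m}) \<subseteq> convex hull (?p ` {..Suc m})"
    by (intro hull_mono image_mono) auto
  ultimately obtain y where y: "y \<in> X" "y \<in> convex hull (?p ` {..Suc m})" "y \<notin> convex hull (?p ` {..m})"
    by blast
  obtain t where t: "y = x + (\<Sum>j<Suc m. t j *\<^sub>R (lam j *\<^sub>R (us ! j)))" "chain_coeffs (Suc m) t"
    using y(2) unfolding convex_hull_chain by blast
  have tm: "chain_coeffs i t" if "i \<le> Suc m" for i using t(2) that by (auto simp: chain_coeffs_def)
  \<comment> \<open>A zero last coefficient would put \<open>y\<close> into the smaller simplex.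
    Once \<open>t m\<close> is positive, monotonicity makes all coefficients positive.\<close>
  have "t m \<noteq> 0"
  proof
    assume "t m = 0"
    then have "y = x + (\<Sum>j<m. t j *\<^sub>R (lam j *\<^sub>R (us ! j)))" using t(1) by simp
    then show False using y(3) tm[of m] unfolding convex_hull_chain by auto
  qed
  then have tpos: "t j > 0" if "j < Suc m" for j
    using t(2) that unfolding chain_coeffs_def by (smt (verit) lessI less_Suc_eq_le)
  show ?case
  proof (intro exI[of _ "\<lambda>j. t j * lam j"] conjI allI impI)
    show "t j * lam j > 0" if "j < Suc m" for j using tpos lam that by simp
    show "x + (\<Sum>j<i. (t j * lam j) *\<^sub>R (us ! j)) \<in> X" if i: "i \<le> Suc m" for i
    proof (cases "i = Suc m")
      case True
      then show ?thesis using y(1) t(1) by simp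
    next
      case False
      \<comment> \<open>The rescaled earlier vertices lie in the simplex spanned by the old
        vertices, which are already known to be in \<open>X\<close>.\<close>
      then have "x + (\<Sum>j<i. t j *\<^sub>R (lam j *\<^sub>R (us ! j))) \<in> X"
        using i by (intro chain_point_in_convex[OF \<open>convex X\<close> _ tm]) (auto intro: lamX)
      then show ?thesis by simp
    qed
  qed
qed

section \<open>Maximal frames and sequences of extreme points\<close>

text \<open>The bound on lengths provides a longest frame among those of subsequences. If infinitely
  many residuals were nonzero, passing to those terms would allow a longer one; so eventually the
  terms differ from \<open>x\<close> by vectors in the span of the frame.\<close>

lemma maximal_frenet_system:
  fixes f :: "nat \<Rightarrow> 'a::euclidean_space"
  assumes "f \<longlonglongrightarrow> x" "\<And>i. f i \<noteq> x"
  obtains r us where "strict_mono r" "frenet_system (f \<circ> r) x us"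
    "\<forall>\<^sub>F i in sequentially. frenet_residual us (length us) x (f (r i)) = 0"
proof -
  let ?P = "\<lambda>k. \<exists>r us. strict_mono r \<and> frenet_system (f \<circ> r) x us \<and> length us = k"
  have "?P 0"
    using assms by (intro exI[of _ id] exI[of _ "[]"]) (auto simp: frenet_system_def strict_mono_def)
  moreover have bound: "k \<le> DIM('a)" if "?P k" for k
    using that frenet_system_length_le by blast
  ultimately obtain k where k: "?P k" "\<And>l. ?P l \<Longrightarrow> l \<le> k"
    using Nat.ex_has_greatest_nat[of ?P 0 "DIM('a)"] by blast
  then obtain r us where r: "strict_mono r" "frenet_system (f \<circ> r) x us" "length us = k" by blast
  have "\<forall>\<^sub>F i in sequentially. frenet_residual us (length us) x (f (r i)) = 0"
  proof (rule ccontr)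
    assume "\<not> ?thesis"
    then have "infinite {i. frenet_residual us (length us) x (f (r i)) \<noteq> 0}"
      by (simp add: cofinite_eq_sequentially[symmetric] eventually_cofinite)
    then obtain s :: "nat \<Rightarrow> nat" where s: "strict_mono s"
        "\<And>i. frenet_residual us (length us) x (f (r (s i))) \<noteq> 0"
      using infinite_enumerate by blast
    obtain q u where q: "strict_mono q" "frenet_system (((f \<circ> r) \<circ> s) \<circ> q) x (us @ [u])"
      using frenet_system_extend[OF frenet_system_subseq[OF r(2) s(1)]] s(2) by (metis comp_apply)
    have "strict_mono (r \<circ> s \<circ> q)" using r(1) s(1) q(1) by (simp add: strict_mono_o)
    then have "?P (Suc k)"
      using q(2) r(3) by (intro exI[of _ "r \<circ> s \<circ> q"] exI[of _ "us @ [u]"]) (simp add: comp_assoc)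
    then show False using k(2)[of "Suc k"] by simp
  qed
  then show thesis using that r by blast
qed

text \<open>Along a sequence of extreme points with a maximal frame, the term \<open>f (r i)\<close> would be the
  midpoint of \<open>x\<close> and \<open>x + 2 (f (r i) - x)\<close>, both in \<open>X\<close>.\<close>
lemma no_outgoing_tangent_imp_polytope:
  fixes X :: "'a::euclidean_space set"
  assumes "compact X" "convex X" and no: "\<And>x us. \<not> outgoing_tangent X x us"
  shows "polytope X"
proof (rule ccontr)
  assume np: "\<not> polytope X"
  let ?E = "{y. y extreme_point_of X}"
  have "X = convex hull ?E" by (rule Krein_Milman_Minkowski[OF assms(1,2)])
  then have "infinite ?E" using np unfolding polytope_def by blast
  moreover have EX: "?E \<subseteq> X" by (auto simp: extreme_point_of_def)
  ultimately obtain x where "x islimpt ?E"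
    using compact_eq_Bolzano_Weierstrass[THEN iffD1, OF assms(1)] by blast
  then obtain f where f: "\<And>i. f i extreme_point_of X" "\<And>i. f i \<noteq> x" "f \<longlonglongrightarrow> x"
    unfolding islimpt_sequential by auto
  obtain r us where r: "strict_mono r" "frenet_system (f \<circ> r) x us"
    "\<forall>\<^sub>F i in sequentially. frenet_residual us (length us) x (f (r i)) = 0"
    using maximal_frenet_system[OF f(3,2)] by blast
  have fX: "(f \<circ> r) i \<in> X" for i using f(1) EX by auto
  obtain lam where lam: "\<forall>j<length us. lam j > 0"
    "\<forall>i\<le>length us. x + (\<Sum>j<i. lam j *\<^sub>R (us ! j)) \<in> X"
    using no_outgoing_tangent_imp_simplex[OF compact_imp_closed[OF assms(1)] assms(2) r(2) fX no order_refl]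
    by blast
  have "x \<in> X" using lam(2)[rule_format, of 0] by simp
  have "\<forall>\<^sub>F i in sequentially.
      x + 2 *\<^sub>R (\<Sum>j<length us. (((f \<circ> r) i - x) \<bullet> (us ! j)) *\<^sub>R (us ! j)) \<in> X"
    by (rule frenet_projection_eventually_in_convex[OF r(2) lam(1)[rule_format] assms(2)
          lam(2)[rule_format]]) simp_all
  with r(3) have "\<forall>\<^sub>F i in sequentially. False"
  proof eventually_elim
    case (elim i)
    let ?y = "f (r i)"
    \<comment> \<open>The vanishing residual identifies the projection in the sum with
      \<open>?y - x\<close>.\<close>
    have "x + 2 *\<^sub>R (?y - x) \<in> X" using elim by (simp add: frenet_residual_def)
    moreover have "x + (x + 2 *\<^sub>R (?y - x)) = 2 *\<^sub>R ?y" by (simp add: scaleR_2)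
    then have "?y = midpoint x (x + 2 *\<^sub>R (?y - x))" by (simp add: midpoint_def)
    then have "?y \<in> open_segment x (x + 2 *\<^sub>R (?y - x))"
      using f(2)[of "r i"] midpoint_in_open_segment[of x "x + 2 *\<^sub>R (?y - x)"] by simp
    ultimately show False using f(1)[of "r i"] \<open>x \<in> X\<close> unfolding extreme_point_of_def by blast
  qed
  then show False by simp
qed

theorem theorem6p4:
  fixes X :: "'a::euclidean_space set"
  assumes "X \<noteq> {}" and "compact X" and "convex X"
  shows "(strongly_semisimple X \<longleftrightarrow> (\<exists>S. finite S \<and> X = convex hull S)) \<and>
         ((\<exists>S. finite S \<and> X = convex hull S) \<longleftrightarrow> \<not> (\<exists>x us. outgoing_tangent X x us))"
  \<comment> \<open>The three implications close the cycle from (II) to (I) to (III) and back to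
    (II).\<close>
  using polytope_imp_strongly_semisimple[of X]
    strongly_semisimple_imp_no_outgoing_tangent[OF \<open>compact X\<close>]
    no_outgoing_tangent_imp_polytope[OF \<open>compact X\<close> \<open>convex X\<close>]
  unfolding polytope_def by blast

end
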